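(* Let $p$ be a prime, $q$ a power of $p$, and $r$ an odd prime coprime with $q$ such that $q$ is a primitive root modulo $r$. Let $\theta$ be the class of $x$ in $\mathbb{F}_q[x]/(\Phi_r(x)) = \mathbb{F}_{q^{r-1}}$, where $\Phi_r(x)=x^{r-1}+x^{r-2}+\dots+x+1$. Let $e$ be any integer, $f$ any integer coprime with $r$, and $a$ any non-zero element of $\mathbb{F}_q$. Then: (a) the element $\theta^e(\theta^f+a)$ has multiplicative order at least $U(r-2,p-1)$; (b) if $a\neq 1,-1$, then the element $\theta^e(\theta^f+a)$ has multiplicative order at least $\frac{1}{2}\,[U((r-3)/2,p-1)]^2$.
   Context: Since $q$ is a primitive root modulo the prime $r$ (i.e. the multiplicative order of $q$ modulo $r$ is $r-1$), the cyclotomic polynomial $\Phi_r(x)$ is irreducible over $\mathbb{F}_q$, so $\mathbb{F}_q[x]/(\Phi_r(x))$ is the field $\mathbb{F}_{q^{r-1}}$ and $\theta$ satisfies $\theta^r=1$. Multiplicative order means order in the group $\mathbb{F}_{q^{r-1}}^*$. For integers $n\ge 0$ and $d\ge 1$, $U(n,d)$ denotes the number of partitions of $n$ in which every part appears at most $d$ times, i.e. the number of tuples of non-negative integers $(u_1,\dots,u_n)$ with $\sum_{j=1}^n j u_j = n$ and $u_j\le d$ for all $j$. *)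

theory Defs
  imports "HOL-Algebra.Polynomial_Divisibility" "HOL-Number_Theory.Number_Theory"
begin

text \<open>
  The number of partitions of \<open>n\<close> in which every part appears at most \<open>d\<close> times; \<open>u j\<close> is the
  multiplicity of the part \<open>j\<close>.
\<close>

definition U_part :: "nat \<Rightarrow> nat \<Rightarrow> nat" where
  "U_part n d = card {u \<in> {1..n} \<rightarrow>\<^sub>E {..d}. (\<Sum>j = 1..n. j * u j) = n}"

text \<open>
  Univariate polynomials are coefficient lists with the leading coefficient first, so the
  list of \<open>r\<close> ones is $x^{r-1} + \dots + x + 1$.
\<close>

definition cyclo_poly :: "('a, 'b) ring_scheme \<Rightarrow> nat \<Rightarrow> 'a list" where
  "cyclo_poly K r = replicate r \<one>\<^bsub>K\<^esub>"

definition cyclo_ext :: "('a, 'b) ring_scheme \<Rightarrow> nat \<Rightarrow> 'a list set ring" where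
  "cyclo_ext K r = Rupt\<^bsub>K\<^esub> (carrier K) (cyclo_poly K r)"

definition cyclo_class :: "('a, 'b) ring_scheme \<Rightarrow> nat \<Rightarrow> 'a list \<Rightarrow> 'a list set" where
  "cyclo_class K r g = ring.rupture_surj K (carrier K) (cyclo_poly K r) g"

definition cyclo_theta :: "('a, 'b) ring_scheme \<Rightarrow> nat \<Rightarrow> 'a list set" where
  "cyclo_theta K r = cyclo_class K r X\<^bsub>K\<^esub>"

definition cyclo_const :: "('a, 'b) ring_scheme \<Rightarrow> nat \<Rightarrow> 'a \<Rightarrow> 'a list set" where
  "cyclo_const K r a = cyclo_class K r (ring.poly_of_const K a)"

text \<open>
  The element $\theta^e (\theta^f + a)$. Integer powers in a ring are defined through the
  multiplicative inverse of its underlying monoid, so they are meaningful for the unit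
  $\theta$ and negative exponents.
\<close>

definition cyclo_elem :: "('a, 'b) ring_scheme \<Rightarrow> nat \<Rightarrow> int \<Rightarrow> int \<Rightarrow> 'a \<Rightarrow> 'a list set" where
  "cyclo_elem K r e f a =
     cyclo_theta K r [^]\<^bsub>cyclo_ext K r\<^esub> e \<otimes>\<^bsub>cyclo_ext K r\<^esub>
     (cyclo_theta K r [^]\<^bsub>cyclo_ext K r\<^esub> f \<oplus>\<^bsub>cyclo_ext K r\<^esub> cyclo_const K r a)"

end

theory Submission
  imports Defs
begin

text \<open>
  Raising \<open>z = \<theta>\<^sup>e (\<theta>\<^sup>f + a)\<close> to powers of \<open>q\<close> permutes the exponents: as \<open>q\<close> is a primitive root
  modulo \<open>r\<close>, some power of \<open>z\<close> is \<open>w = \<theta>\<^bsup>e'\<^esup> (\<theta> + a)\<close>, and for every \<open>j\<close> prime to \<open>r\<close> the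
  element \<open>\<theta>\<^bsup>e'j\<^esup> (\<theta>\<^sup>j + a)\<close> is a power of \<open>w\<close>. A partition \<open>u\<close> of \<open>r - 2\<close> thus yields the power
  \<open>\<theta>\<^bsup>e'(r - 2)\<^esup> \<Prod>\<^sub>j (\<theta>\<^sup>j + a)\<^bsup>u j\<^esup>\<close> of \<open>w\<close>, and two of these coincide only if the
  polynomials \<open>\<Prod>\<^sub>j (x\<^sup>j + a)\<^bsup>u j\<^esup>\<close>, whose degree is below \<open>r - 1\<close>, coincide. At the least index \<open>i\<close> at
  which two partitions differ, cancel the common factors and compare the coefficients of \<open>x\<^sup>i\<close>:
  this gives \<open>u i\<close> modulo \<open>p\<close>, hence \<open>u i\<close>.

  For the second bound let \<open>Q = q\<^bsup>(r - 1)/2\<^esup>\<close>, so \<open>Q \<equiv> -1\<close> modulo \<open>r\<close>. Since the order of \<open>w\<close> divides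
  \<open>(Q - 1)(Q + 1)\<close>, it is at least the product of the orders of \<open>w\<^bsup>Q - 1\<^esup>\<close> and \<open>w\<^bsup>Q + 1\<^esup>\<close>. Up to powers of
  \<open>\<theta>\<close> these elements are \<open>(a \<theta> + 1)/(\<theta> + a)\<close> and \<open>(\<theta> + a)(a \<theta> + 1)\<close>, and each has at least
  \<open>U((r - 3)/2, p - 1)\<close> distinct powers by the same argument.
\<close>

section \<open>Commutative rings of prime characteristic\<close>

text \<open>Serves only the additivity of the Frobenius map. Natural coefficients act as iterated
  sums, and the induction is Pascal's rule applied termwise.\<close>

lemma (in cring) binomial:
  assumes "x \<in> carrier R" "y \<in> carrier R"
  shows "(x \<oplus> y) [^] n = (\<Oplus>k\<in>{..n}. [(n choose k)] \<cdot> (x [^] k \<otimes> y [^] (n - k)))"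
proof (induction n)
  case 0
  show ?case using assms by simp
next
  case (Suc n)
  define T where "T k = [(n choose k)] \<cdot> (x [^] k \<otimes> y [^] (n - k))" for k
  define V where "V k = [(n choose k)] \<cdot> (x [^] k \<otimes> y [^] (Suc n - k))" for k
  have cl: "T k \<in> carrier R" "V k \<in> carrier R" for k
    using assms by (simp_all add: T_def V_def)
  have Tx: "x \<otimes> T k = [(n choose k)] \<cdot> (x [^] Suc k \<otimes> y [^] (n - k))" for k
    using assms by (simp add: T_def add_pow_rdistr m_ac)
  have Ty: "y \<otimes> T k = V k" if "k \<in> {..n}" for k
  proof -
    have "y [^] (Suc n - k) = y \<otimes> y [^] (n - k)"
      using that assms by (simp add: Suc_diff_le m_comm)
    then show ?thesis
      using assms by (simp add: T_def V_def add_pow_rdistr m_ac)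
  qed
  have pascal: "[(Suc n choose Suc k)] \<cdot> (x [^] Suc k \<otimes> y [^] (Suc n - Suc k)) = x \<otimes> T k \<oplus> V (Suc k)" for k
    using assms unfolding Tx V_def by (simp add: add.nat_pow_mult)
  have "(x \<oplus> y) [^] Suc n = (x \<oplus> y) \<otimes> (\<Oplus>k\<in>{..n}. T k)"
    using Suc assms by (simp add: T_def m_comm)
  also have "\<dots> = x \<otimes> (\<Oplus>k\<in>{..n}. T k) \<oplus> y \<otimes> (\<Oplus>k\<in>{..n}. T k)"
    using assms cl by (intro l_distr) auto
  also have "y \<otimes> (\<Oplus>k\<in>{..n}. T k) = (\<Oplus>k\<in>{..n}. V k)"
    using assms cl by (subst finsum_rdistr) (auto simp: Ty intro!: finsum_cong')
  \<comment> \<open>The added term \<open>V (Suc n)\<close> is zero because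
    \<open>n choose Suc n\<close> is; with it the sum can be split at index 0 instead.\<close>
  also have "(\<Oplus>k\<in>{..n}. V k) = (\<Oplus>k\<in>{..Suc n}. V k)"
    using cl by (simp add: finsum_Suc Pi_def) (simp add: V_def binomial_eq_0)
  also have "\<dots> = (\<Oplus>k\<in>{..n}. V (Suc k)) \<oplus> V 0"
    using cl by (intro finsum_Suc2) auto
  also have "x \<otimes> (\<Oplus>k\<in>{..n}. T k) = (\<Oplus>k\<in>{..n}. x \<otimes> T k)"
    using assms cl by (simp add: finsum_rdistr Pi_def)
  also have "(\<Oplus>k\<in>{..n}. x \<otimes> T k) \<oplus> ((\<Oplus>k\<in>{..n}. V (Suc k)) \<oplus> V 0)
      = (\<Oplus>k\<in>{..n}. x \<otimes> T k \<oplus> V (Suc k)) \<oplus> V 0"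
    using assms cl by (simp add: finsum_addf a_assoc Pi_def)
  also have "\<dots> = (\<Oplus>k\<in>{..Suc n}. [(Suc n choose k)] \<cdot> (x [^] k \<otimes> y [^] (Suc n - k)))"
    using assms cl by (subst finsum_Suc2) (auto simp only: pascal, auto simp: V_def)
  finally show ?case .
qed

lemma (in cring) add_pow_dvd_eq_zero:
  assumes "[p] \<cdot> \<one> = \<zero>" "p dvd n" "x \<in> carrier R"
  shows "[(n::nat)] \<cdot> x = \<zero>"
proof -
  from assms(2) obtain m where "n = p * m" by (elim dvdE)
  then have "[n] \<cdot> x = [p] \<cdot> \<one> \<otimes> [m] \<cdot> x"
    using assms(3) by (simp add: add_pow_ldistr add.nat_pow_pow mult.commute)
  then show ?thesis using assms by simp
qed

text \<open>In the binomial expansion every coefficient strictly between the two ends is divisible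
  by \<open>p\<close>.\<close>

lemma (in cring) frobenius_add:
  fixes p :: nat
  assumes p: "Factorial_Ring.prime p" and char: "[p] \<cdot> \<one> = \<zero>"
    and xy: "x \<in> carrier R" "y \<in> carrier R"
  shows "(x \<oplus> y) [^] p = x [^] p \<oplus> y [^] p"
proof -
  define T where "T k = [(p choose k)] \<cdot> (x [^] k \<otimes> y [^] (p - k))" for k
  have cl: "T k \<in> carrier R" for k
    using xy by (simp add: T_def)
  obtain m where m: "p = Suc (Suc m)"
    using prime_ge_2_nat[OF p] by (metis add_2_eq_Suc le_Suc_ex)
  have van: "T (Suc k) = \<zero>" if "k \<in> {..m}" for k
  proof -
    \<comment> \<open>By absorption this product is \<open>p\<close> times a binomial coefficient,
      while \<open>Suc k\<close> is smaller than \<open>p\<close>.\<close>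
    have "p dvd (p choose Suc k) * Suc k"
      using Suc_times_binomial_eq[of "Suc m" k] m by (metis dvd_triv_left)
    moreover have "\<not> p dvd Suc k"
      using that m by (auto dest: dvd_imp_le)
    ultimately have "p dvd (p choose Suc k)"
      using p prime_dvd_mult_iff by blast
    then show ?thesis
      unfolding T_def using xy by (intro add_pow_dvd_eq_zero[OF char]) auto
  qed
  have "(x \<oplus> y) [^] p = (\<Oplus>k\<in>{..p}. T k)"
    using binomial[OF xy, of p] by (simp add: T_def)
  also have "\<dots> = T p \<oplus> ((\<Oplus>k\<in>{..m}. T (Suc k)) \<oplus> T 0)"
  proof -
    have "(\<Oplus>k\<in>{..p}. T k) = T p \<oplus> (\<Oplus>k\<in>{..Suc m}. T k)"
      unfolding m by (rule finsum_Suc) (use cl in auto)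
    also have "(\<Oplus>k\<in>{..Suc m}. T k) = (\<Oplus>k\<in>{..m}. T (Suc k)) \<oplus> T 0"
      by (rule finsum_Suc2) (use cl in auto)
    finally show ?thesis .
  qed
  also have "(\<Oplus>k\<in>{..m}. T (Suc k)) = (\<Oplus>k\<in>{..m}. \<zero>)"
    using van cl by (intro finsum_cong') auto
  finally show ?thesis
    using xy by (simp add: T_def)
qed

lemma (in cring) frobenius_power_add:
  fixes p :: nat
  assumes p: "Factorial_Ring.prime p" and char: "[p] \<cdot> \<one> = \<zero>"
    and xy: "x \<in> carrier R" "y \<in> carrier R"
  shows "(x \<oplus> y) [^] (p ^ s) = x [^] (p ^ s) \<oplus> y [^] (p ^ s)"
proof (induction s)
  case (Suc s)
  have "(x \<oplus> y) [^] (p ^ Suc s) = ((x \<oplus> y) [^] (p ^ s)) [^] p"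
    using xy by (simp add: nat_pow_pow mult.commute)
  then show ?case
    using xy Suc by (simp add: frobenius_add[OF p char] nat_pow_pow mult.commute)
qed (use xy in simp)

lemma (in domain) nat_pow_nonzero:
  "x \<in> carrier R \<Longrightarrow> x \<noteq> \<zero> \<Longrightarrow> x [^] (k :: nat) \<noteq> \<zero>"
  by (induction k) (auto simp: integral_iff)

text \<open>The order \<open>p ^ k\<close> of the additive group annihilates \<open>\<one>\<close>,
  and \<open>[(p ^ k)] \<cdot> \<one>\<close> is the \<open>k\<close>-th power of
  \<open>[p] \<cdot> \<one>\<close>. A field has no non-zero nilpotent element.\<close>

lemma (in field) finite_field_char:
  assumes "finite (carrier R)" "card (carrier R) = p ^ k"
  shows "[p] \<cdot> \<one> = \<zero>"
proof -
  have "[(p ^ k)] \<cdot> \<one> = \<zero>"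
    using add.pow_order_eq_1[of \<one>] assms by (simp add: add_pow_def order_def)
  moreover have "[(p ^ k)] \<cdot> \<one> = ([p] \<cdot> \<one>) [^] k" for k :: nat
  proof (induction k)
    case (Suc k)
    have "[(p ^ Suc k)] \<cdot> \<one> = [p] \<cdot> ([(p ^ k)] \<cdot> \<one>)"
      by (simp add: add.nat_pow_pow mult.commute)
    then show ?case
      using Suc by (simp add: add_pow_rdistr)
  qed simp
  ultimately have "([p] \<cdot> \<one>) [^] k = \<zero>" by simp
  then show ?thesis
    using nat_pow_nonzero by blast
qed

lemma (in field) finite_field_pow_card:
  assumes "finite (carrier R)" "x \<in> carrier R"
  shows "x [^] card (carrier R) = x"
proof (cases "x = \<zero>")
  case True
  then show ?thesis
    using assms card_gt_0_iff[of "carrier R"] by (auto intro!: nat_pow_zero simp del: card_gt_0_iff)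
next
  case False
  interpret G: group "Multiplicative_Group.mult_of R" by (rule field_mult_group)
  have "x [^] (card (carrier R) - 1) = \<one>"
    using G.pow_order_eq_1[of x] False assms order_mult_of by (simp add: Multiplicative_Group.nat_pow_mult_of order_def)
  then have "x [^] Suc (card (carrier R) - 1) = x"
    using assms(2) by simp
  moreover have "card (carrier R) > 0"
    using assms by (auto simp: card_gt_0_iff)
  ultimately show ?thesis by simp
qed

section \<open>First-order jets\<close>

text \<open>
  An abstraction of a polynomial ring over a field: \<open>F\<close> are the constants and \<open>\<xi>\<close> is the variable.
\<close>

locale poly_like = domain R for R (structure) +
  fixes F \<xi>
  assumes subfield_F: "subfield F R"
    and xi_carrier [simp]: "\<xi> \<in> carrier R"
    and xi_nonzero: "\<xi> \<noteq> \<zero>"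
    and multiple_xi_const: "\<lbrakk>z \<in> carrier R; \<xi> \<otimes> z \<in> F\<rbrakk> \<Longrightarrow> \<xi> \<otimes> z = \<zero>"
begin

text \<open>
  The relative coefficient \<open>d\<close>, rather than the absolute one, is recorded because it is additive
  under products, like a logarithmic derivative.
\<close>

definition log_jet :: "nat \<Rightarrow> 'a \<Rightarrow> 'a \<Rightarrow> bool" where
  "log_jet m P d \<longleftrightarrow> d \<in> F \<and>
     (\<exists>c\<in>F - {\<zero>}. \<exists>z\<in>carrier R. P = c \<otimes> (\<one> \<oplus> d \<otimes> \<xi> [^] m) \<oplus> \<xi> [^] Suc m \<otimes> z)"

lemma F_carrier: "x \<in> F \<Longrightarrow> x \<in> carrier R"
  using subringE(1)[OF subfieldE(1)[OF subfield_F]] by blast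

lemma F_closed:
  "\<zero> \<in> F" "\<one> \<in> F" "x \<in> F \<Longrightarrow> y \<in> F \<Longrightarrow> x \<otimes> y \<in> F" "x \<in> F \<Longrightarrow> y \<in> F \<Longrightarrow> x \<oplus> y \<in> F"
  "x \<in> F \<Longrightarrow> \<ominus> x \<in> F" "x \<in> F \<Longrightarrow> y \<in> F \<Longrightarrow> x \<ominus> y \<in> F"
  using subringE[OF subfieldE(1)[OF subfield_F]] by (auto simp: a_minus_def)

lemma log_jet_one: "log_jet m \<one> \<zero>"
proof -
  have "\<one> = \<one> \<otimes> (\<one> \<oplus> \<zero> \<otimes> \<xi> [^] m) \<oplus> \<xi> [^] Suc m \<otimes> \<zero>" by simp
  then show ?thesis
    unfolding log_jet_def
    by (intro conjI bexI[of _ \<one>] bexI[of _ \<zero>] F_closed) (simp_all add: F_closed)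
qed

lemma log_jet_carrier: "log_jet m P d \<Longrightarrow> P \<in> carrier R"
  unfolding log_jet_def by (auto simp: F_carrier)

text \<open>The product of \<open>1 + d x^m\<close> and \<open>1 + d' x^m\<close> has linear part
  \<open>d + d'\<close>; the remaining term \<open>d d' x^(2m)\<close> is absorbed by the remainder
  since \<open>2m \<ge> m + 1\<close> for \<open>m \<ge> 1\<close>.\<close>

lemma log_jet_mult:
  assumes m: "m \<ge> 1" and P: "log_jet m P d" and Q: "log_jet m Q d'"
  shows "log_jet m (P \<otimes> Q) (d \<oplus> d')"
proof -
  obtain c z where c: "c \<in> F - {\<zero>}" and z: "z \<in> carrier R"
    and P_eq: "P = c \<otimes> (\<one> \<oplus> d \<otimes> \<xi> [^] m) \<oplus> \<xi> [^] Suc m \<otimes> z" and d: "d \<in> F"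
    using P unfolding log_jet_def by auto
  obtain c' z' where c': "c' \<in> F - {\<zero>}" and z': "z' \<in> carrier R"
    and Q_eq: "Q = c' \<otimes> (\<one> \<oplus> d' \<otimes> \<xi> [^] m) \<oplus> \<xi> [^] Suc m \<otimes> z'" and d': "d' \<in> F"
    using Q unfolding log_jet_def by auto
  obtain n where n: "m = Suc n" using m by (cases m) auto
  define E A B where "E = \<xi> [^] m" and "A = c \<otimes> (\<one> \<oplus> d \<otimes> E)" and "B = c' \<otimes> (\<one> \<oplus> d' \<otimes> E)"
  define Y E1 where "Y = \<xi> [^] n" and "E1 = \<xi> [^] Suc m"
  have cl [simp]: "c \<in> carrier R" "c' \<in> carrier R" "d \<in> carrier R" "d' \<in> carrier R"
      "z \<in> carrier R" "z' \<in> carrier R" "E \<in> carrier R" "Y \<in> carrier R" "E1 \<in> carrier R"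
    using c c' d d' z z' by (auto simp: F_carrier E_def Y_def E1_def)
  have cl' [simp]: "A \<in> carrier R" "B \<in> carrier R"
    by (simp_all add: A_def B_def)
  \<comment> \<open>With \<open>Y\<close> equal to \<open>\<xi> [^] (m - 1)\<close>, this is where
    \<open>m \<ge> 1\<close> enters.\<close>
  have EE: "E \<otimes> E = E1 \<otimes> Y"
  proof -
    have "E = Y \<otimes> \<xi>" "E1 = Y \<otimes> \<xi> \<otimes> \<xi>"
      by (simp_all add: E_def E1_def Y_def n)
    then show ?thesis by (simp add: m_ac)
  qed
  define w where "w = (A \<otimes> z' \<oplus> z \<otimes> B \<oplus> E1 \<otimes> z \<otimes> z') \<oplus> Y \<otimes> (c \<otimes> c' \<otimes> d \<otimes> d')"
  have "A \<otimes> B = c \<otimes> c' \<otimes> ((\<one> \<oplus> d \<otimes> E) \<otimes> (\<one> \<oplus> d' \<otimes> E))"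
    by (simp add: A_def B_def m_ac)
  also have "(\<one> \<oplus> d \<otimes> E) \<otimes> (\<one> \<oplus> d' \<otimes> E) = (\<one> \<oplus> (d \<oplus> d') \<otimes> E) \<oplus> d \<otimes> d' \<otimes> (E \<otimes> E)"
    by (simp add: l_distr r_distr m_ac a_ac)
  finally have AB: "A \<otimes> B = c \<otimes> c' \<otimes> (\<one> \<oplus> (d \<oplus> d') \<otimes> E) \<oplus> E1 \<otimes> (Y \<otimes> (c \<otimes> c' \<otimes> d \<otimes> d'))"
    unfolding EE by (simp add: r_distr m_ac)
  have "P \<otimes> Q = (A \<oplus> E1 \<otimes> z) \<otimes> (B \<oplus> E1 \<otimes> z')"
    unfolding P_eq Q_eq by (simp add: A_def B_def E_def E1_def)
  also have "\<dots> = A \<otimes> B \<oplus> E1 \<otimes> (A \<otimes> z' \<oplus> z \<otimes> B \<oplus> E1 \<otimes> z \<otimes> z')"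
    by (simp add: l_distr r_distr m_ac a_ac)
  also have "\<dots> = c \<otimes> c' \<otimes> (\<one> \<oplus> (d \<oplus> d') \<otimes> E) \<oplus> E1 \<otimes> w"
    unfolding AB w_def by (simp add: r_distr a_ac)
  finally have "P \<otimes> Q = c \<otimes> c' \<otimes> (\<one> \<oplus> (d \<oplus> d') \<otimes> \<xi> [^] m) \<oplus> \<xi> [^] Suc m \<otimes> w"
    by (simp add: E_def E1_def)
  moreover have "c \<otimes> c' \<in> F - {\<zero>}"
    using c c' by (auto simp: F_closed F_carrier integral_iff)
  moreover have "w \<in> carrier R" by (simp add: w_def)
  ultimately show ?thesis
    unfolding log_jet_def using d d' by (blast intro: F_closed)
qed

lemma log_jet_pow:
  assumes "m \<ge> 1" "log_jet m P d"
  shows "log_jet m (P [^] (u :: nat)) ([u] \<cdot> d)"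
proof (induction u)
  case (Suc u)
  then show ?case using log_jet_mult[OF assms(1) Suc assms(2)] by simp
qed (simp add: log_jet_one)

lemma log_jet_finprod_zero:
  assumes m: "m \<ge> 1" and S: "finite S" "\<And>j. j \<in> S \<Longrightarrow> log_jet m (P j) \<zero>"
  shows "log_jet m (\<Otimes>j\<in>S. P j) \<zero>"
  using S
proof (induction S)
  case (insert j S)
  then have "P \<in> S \<rightarrow> carrier R" "P j \<in> carrier R"
    using log_jet_carrier by blast+
  then show ?case
    using insert log_jet_mult[OF m, of "P j" \<zero> "\<Otimes>j\<in>S. P j" \<zero>] by simp
qed (simp add: log_jet_one)

text \<open>\<open>multiple_xi_const\<close> is applied twice: first to identify the constant
  factors \<open>c\<close> and \<open>c'\<close>, then, after cancelling \<open>\<xi> [^] m\<close>,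
  to identify the relative coefficients.\<close>

lemma log_jet_unique:
  assumes m: "m \<ge> 1" and P: "log_jet m P d" and Q: "log_jet m P d'"
  shows "d = d'"
proof -
  obtain c z where c: "c \<in> F - {\<zero>}" and z: "z \<in> carrier R"
    and P_eq: "P = c \<otimes> (\<one> \<oplus> d \<otimes> \<xi> [^] m) \<oplus> \<xi> [^] Suc m \<otimes> z" and d: "d \<in> F"
    using P unfolding log_jet_def by auto
  obtain c' z' where c': "c' \<in> F - {\<zero>}" and z': "z' \<in> carrier R"
    and Q_eq: "P = c' \<otimes> (\<one> \<oplus> d' \<otimes> \<xi> [^] m) \<oplus> \<xi> [^] Suc m \<otimes> z'" and d': "d' \<in> F"
    using Q unfolding log_jet_def by auto
  obtain n where n: "m = Suc n" using m by (cases m) auto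
  define Y E where "Y = \<xi> [^] n" and "E = \<xi> [^] m"
  have cl [simp]: "c \<in> carrier R" "c' \<in> carrier R" "d \<in> carrier R" "d' \<in> carrier R"
      "z \<in> carrier R" "z' \<in> carrier R" "Y \<in> carrier R" "E \<in> carrier R"
    using c c' d d' z z' by (auto simp: F_carrier Y_def E_def)
  have E: "E = \<xi> \<otimes> Y"
    by (simp add: E_def Y_def n m_comm)
  have diff: "a \<ominus> b = v \<ominus> u" if "a \<oplus> u = b \<oplus> v" "a \<in> carrier R" "b \<in> carrier R" "u \<in> carrier R" "v \<in> carrier R" for a b u v
  proof -
    have "a \<ominus> b = (a \<oplus> u) \<ominus> u \<ominus> b" using that(2-) by (simp add: a_minus_def a_assoc r_neg)
    also have "\<dots> = (v \<ominus> u) \<oplus> (b \<ominus> b)"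
      unfolding that(1) using that(2-) by (simp add: a_minus_def a_ac)
    also have "\<dots> = v \<ominus> u" using that(2-) by (simp add: a_minus_def r_neg)
    finally show ?thesis .
  qed
  have P1: "P = c \<otimes> (\<one> \<oplus> d \<otimes> E) \<oplus> E \<otimes> (\<xi> \<otimes> z)" and P2: "P = c' \<otimes> (\<one> \<oplus> d' \<otimes> E) \<oplus> E \<otimes> (\<xi> \<otimes> z')"
    using P_eq Q_eq by (simp_all add: E_def m_assoc)
  \<comment> \<open>As \<open>m \<ge> 1\<close>, everything but the constant term is a multiple of
    \<open>\<xi>\<close>.\<close>
  have "P = c \<oplus> \<xi> \<otimes> (Y \<otimes> (c \<otimes> d \<oplus> \<xi> \<otimes> z))"
    unfolding P1 E by (simp add: r_distr m_ac a_ac)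
  moreover have "P = c' \<oplus> \<xi> \<otimes> (Y \<otimes> (c' \<otimes> d' \<oplus> \<xi> \<otimes> z'))"
    unfolding P2 E by (simp add: r_distr m_ac a_ac)
  ultimately have "c \<ominus> c' = \<xi> \<otimes> (Y \<otimes> (c' \<otimes> d' \<oplus> \<xi> \<otimes> z')) \<ominus> \<xi> \<otimes> (Y \<otimes> (c \<otimes> d \<oplus> \<xi> \<otimes> z))"
    by (intro diff) simp_all
  then have eq1: "c \<ominus> c' = \<xi> \<otimes> (Y \<otimes> (c' \<otimes> d' \<oplus> \<xi> \<otimes> z') \<ominus> Y \<otimes> (c \<otimes> d \<oplus> \<xi> \<otimes> z))"
    by (simp add: a_minus_def r_distr r_minus)
  have "c \<ominus> c' \<in> F" using c c' by (auto intro: F_closed)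
  with eq1 have "c \<ominus> c' = \<zero>"
    using multiple_xi_const[of "Y \<otimes> (c' \<otimes> d' \<oplus> \<xi> \<otimes> z') \<ominus> Y \<otimes> (c \<otimes> d \<oplus> \<xi> \<otimes> z)"] by simp
  then have cc: "c' = c" by simp
  have "c \<oplus> E \<otimes> (c \<otimes> d \<oplus> \<xi> \<otimes> z) = c \<oplus> E \<otimes> (c \<otimes> d' \<oplus> \<xi> \<otimes> z')"
    using P1 P2 unfolding cc by (simp add: r_distr m_ac a_ac)
  then have "E \<otimes> (c \<otimes> d \<oplus> \<xi> \<otimes> z) = E \<otimes> (c \<otimes> d' \<oplus> \<xi> \<otimes> z')"
    by simp
  moreover have "E \<noteq> \<zero>"
    using xi_nonzero by (simp add: E_def nat_pow_nonzero)
  ultimately have "c \<otimes> d \<oplus> \<xi> \<otimes> z = c \<otimes> d' \<oplus> \<xi> \<otimes> z'"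
    by (simp add: m_lcancel)
  then have "c \<otimes> d \<ominus> c \<otimes> d' = \<xi> \<otimes> z' \<ominus> \<xi> \<otimes> z"
    by (intro diff) simp_all
  then have eq2: "c \<otimes> (d \<ominus> d') = \<xi> \<otimes> (z' \<ominus> z)"
    by (simp add: a_minus_def r_distr r_minus)
  have "c \<otimes> (d \<ominus> d') \<in> F" using c d d' by (auto intro: F_closed)
  with eq2 have "c \<otimes> (d \<ominus> d') = \<zero>"
    using multiple_xi_const[of "z' \<ominus> z"] by simp
  then show ?thesis using c by (auto simp: integral_iff)
qed

end

text \<open>The additive order of \<open>\<one>\<close> divides the prime \<open>p\<close> and is
  not 1, so it equals \<open>p\<close>.\<close>

lemma (in domain) add_pow_eq_zero_dvd:
  fixes p w :: nat
  assumes p: "Factorial_Ring.prime p" and char: "[p] \<cdot> \<one> = \<zero>"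
    and x: "x \<in> carrier R" "x \<noteq> \<zero>" and w: "[w] \<cdot> x = \<zero>"
  shows "p dvd w"
proof -
  have "[w] \<cdot> \<one> \<otimes> x = \<zero>"
    using w x by (simp add: add_pow_ldistr)
  then have "[w] \<cdot> \<one> = \<zero>"
    using x integral_iff by auto
  moreover have "add.ord \<one> \<noteq> 1"
    using add.ord_eq_1[of \<one>] by simp
  ultimately show ?thesis
    using char p add.pow_eq_id[of \<one>] by (metis one_closed prime_nat_iff)
qed

text \<open>The last equation says
  \<open>[u] \<cdot> (a \<ominus> b) = [v] \<cdot> (a \<ominus> b)\<close> without subtraction.
  Hence \<open>p\<close> divides the difference of \<open>u\<close> and \<open>v\<close>, which is
  smaller than \<open>p\<close>.\<close>

lemma (in domain) add_pow_exchange_imp_eq: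
  fixes p u v :: nat
  assumes p: "Factorial_Ring.prime p" and char: "[p] \<cdot> \<one> = \<zero>"
    and ab: "a \<in> carrier R" "b \<in> carrier R" "a \<noteq> b"
    and "u < p" "v < p" "[u] \<cdot> a \<oplus> [v] \<cdot> b = [v] \<cdot> a \<oplus> [u] \<cdot> b"
  shows "u = v"
  using assms(6-)
proof (induction u v rule: linorder_wlog)
  case (le u v)
  obtain w where w: "v = u + w" using le(1) le_Suc_ex by blast
  have "([u] \<cdot> a \<oplus> [u] \<cdot> b) \<oplus> [w] \<cdot> b = ([u] \<cdot> a \<oplus> [u] \<cdot> b) \<oplus> [w] \<cdot> a"
    using le(4) ab by (simp add: w add.nat_pow_mult[symmetric] a_ac)
  then have "[w] \<cdot> b = [w] \<cdot> a" using ab by simp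
  then have "[w] \<cdot> \<one> \<otimes> b = [w] \<cdot> \<one> \<otimes> a"
    using ab by (simp add: add_pow_ldistr)
  then have "[w] \<cdot> \<one> \<otimes> (a \<ominus> b) = \<zero>"
    using ab by (simp add: a_minus_def r_distr r_minus r_neg)
  then have "[w] \<cdot> (a \<ominus> b) = \<zero>"
    using ab by (simp add: add_pow_ldistr)
  moreover have "a \<ominus> b \<noteq> \<zero>" using ab by simp
  ultimately have "p dvd w"
    using add_pow_eq_zero_dvd[OF p char] ab by blast
  then show ?case using w le by (auto dest: dvd_imp_le)
qed simp

lemma (in domain) finprod_nonzero:
  assumes "finite S" "\<And>j. j \<in> S \<Longrightarrow> P j \<in> carrier R - {\<zero>}"
  shows "(\<Otimes>j\<in>S. P j) \<noteq> \<zero>"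
  using assms
proof (induction S)
  case (insert j S)
  then have "P \<in> S \<rightarrow> carrier R" "P j \<in> carrier R" "P j \<noteq> \<zero>" by auto
  with insert show ?case by (simp add: integral_iff)
qed simp

section \<open>Recovering exponents from jets\<close>

context poly_like
begin

lemma F_inverse:
  assumes "c \<in> F" "c \<noteq> \<zero>"
  shows "inv c \<in> F" "c \<otimes> inv c = \<one>" "inv c \<otimes> c = \<one>"
  using subfield_m_inv[OF subfield_F, of c] assms by auto

lemma log_jet_linear:
  assumes "b \<in> F" "c \<in> F" "c \<noteq> \<zero>"
  shows "log_jet j (b \<otimes> \<xi> [^] j \<oplus> c) (b \<otimes> inv c)"
proof -
  have cl: "b \<in> carrier R" "c \<in> carrier R" "inv c \<in> carrier R"
    using assms F_inverse(1) by (auto simp: F_carrier)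
  have "c \<otimes> (b \<otimes> inv c \<otimes> \<xi> [^] j) = c \<otimes> inv c \<otimes> (b \<otimes> \<xi> [^] j)"
    using cl by (simp add: m_ac)
  then have "b \<otimes> \<xi> [^] j \<oplus> c = c \<otimes> (\<one> \<oplus> b \<otimes> inv c \<otimes> \<xi> [^] j) \<oplus> \<xi> [^] Suc j \<otimes> \<zero>"
    using cl F_inverse[OF assms(2,3)] by (simp add: r_distr a_comm)
  then show ?thesis
    unfolding log_jet_def using assms F_inverse[OF assms(2,3)] F_closed by blast
qed

text \<open>The term in \<open>\<xi> [^] j\<close> is divisible by \<open>\<xi> [^] Suc i\<close>
  and disappears in the remainder.\<close>

lemma log_jet_linear_below:
  assumes "b \<in> F" "c \<in> F" "c \<noteq> \<zero>" "i < j"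
  shows "log_jet i (b \<otimes> \<xi> [^] j \<oplus> c) \<zero>"
proof -
  have cl: "b \<in> carrier R" "c \<in> carrier R"
    using assms by (auto simp: F_carrier)
  obtain k where "j = Suc i + k" using assms(4) less_iff_Suc_add by auto
  then have "b \<otimes> \<xi> [^] j \<oplus> c = c \<otimes> (\<one> \<oplus> \<zero> \<otimes> \<xi> [^] i) \<oplus> \<xi> [^] Suc i \<otimes> (b \<otimes> \<xi> [^] k)"
    using cl by (simp add: nat_pow_mult[symmetric] m_ac a_comm del: nat_pow_Suc)
  moreover have "b \<otimes> \<xi> [^] k \<in> carrier R" using cl by simp
  ultimately show ?thesis
    unfolding log_jet_def using assms F_closed(1) by blast
qed

text \<open>
  The equation is the cross-multiplied form of \<open>\<Prod>\<^sub>j (B j / A j)\<^bsup>u j\<^esup> = \<Prod>\<^sub>j (B j / A j)\<^bsup>v j\<^esup>\<close>.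
\<close>

lemma log_jet_pairs_unique:
  fixes p n :: nat and u v m :: "nat \<Rightarrow> nat"
  assumes p: "Factorial_Ring.prime p" and char: "[p] \<cdot> \<one> = \<zero>"
    and nz: "\<And>j. j \<in> {1..n} \<Longrightarrow> A j \<in> carrier R - {\<zero>} \<and> B j \<in> carrier R - {\<zero>}"
    and m: "\<And>j. j \<in> {1..n} \<Longrightarrow> m j \<ge> 1"
    and diag: "\<And>j. j \<in> {1..n} \<Longrightarrow> log_jet (m j) (A j) (dA j) \<and> log_jet (m j) (B j) (dB j) \<and> dA j \<noteq> dB j"
    and above: "\<And>i j. i \<in> {1..n} \<Longrightarrow> j \<in> {1..n} \<Longrightarrow> i < j \<Longrightarrow> log_jet (m i) (A j) \<zero> \<and> log_jet (m i) (B j) \<zero>"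
    and uv: "\<And>j. j \<in> {1..n} \<Longrightarrow> u j < p \<and> v j < p"
    and eq: "(\<Otimes>j\<in>{1..n}. B j [^] u j \<otimes> A j [^] v j) = (\<Otimes>j\<in>{1..n}. B j [^] v j \<otimes> A j [^] u j)"
    and i: "i \<in> {1..n}"
  shows "u i = v i"
  using i
proof (induction i rule: less_induct)
  case (less i)
  define f where "f w w' j = B j [^] w j \<otimes> A j [^] w' j" for w w' :: "nat \<Rightarrow> nat" and j
  have f_nz: "f w w' j \<in> carrier R - {\<zero>}" if "j \<in> {1..n}" for w w' j
    using nz[OF that] by (auto simp: f_def integral_iff nat_pow_nonzero)
  have f_cl: "f w w' \<in> S \<rightarrow> carrier R" if "S \<subseteq> {1..n}" for w w' S
    using f_nz that by blast
  have S: "{1..n} = {1..<i} \<union> insert i {i<..n}" "{1..<i} \<subseteq> {1..n}" "{i<..n} \<subseteq> {1..n}"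
    using less.prems by auto
  \<comment> \<open>The product is cut at \<open>i\<close>. Exchanging \<open>u\<close> and
    \<open>v\<close> leaves the head unchanged by induction, so the head cancels and only the tails
    are compared.\<close>
  define tail where "tail w w' = f w w' i \<otimes> (\<Otimes>j\<in>{i<..n}. f w w' j)" for w w'
  have split: "(\<Otimes>j\<in>{1..n}. f w w' j) = (\<Otimes>j\<in>{1..<i}. f w w' j) \<otimes> tail w w'" for w w'
  proof -
    have "(\<Otimes>j\<in>{1..n}. f w w' j) = (\<Otimes>j\<in>{1..<i}. f w w' j) \<otimes> (\<Otimes>j\<in>insert i {i<..n}. f w w' j)"
      unfolding S(1) by (rule finprod_Un_disjoint) (use S(2,3) f_cl[of "{1..<i}"] f_cl[of "insert i {i<..n}"] less.prems in auto)
    also have "(\<Otimes>j\<in>insert i {i<..n}. f w w' j) = tail w w'"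
      unfolding tail_def using f_cl[OF S(3)] f_nz[OF less.prems] by (intro finprod_insert) auto
    finally show ?thesis .
  qed
  have head_eq: "(\<Otimes>j\<in>{1..<i}. f u v j) = (\<Otimes>j\<in>{1..<i}. f v u j)"

  proof (rule finprod_cong'[OF refl f_cl[OF S(2)]])
    fix j assume "j \<in> {1..<i}"
    then have "u j = v j" using less by auto
    then show "f u v j = f v u j" by (simp add: f_def)
  qed
  have head_nz: "(\<Otimes>j\<in>{1..<i}. f v u j) \<noteq> \<zero>"
    using f_nz S(2) by (intro finprod_nonzero) auto
  \<comment> \<open>Factors of index above \<open>i\<close> have relative coefficient zero at order
    \<open>m i\<close>, so the jet sees the \<open>i\<close>-th factor alone.\<close>
  have tail_jet: "log_jet (m i) (tail w w') ([w i] \<cdot> dB i \<oplus> [w' i] \<cdot> dA i)" for w w'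
  proof -
    note mi = m[OF less.prems]
    have "log_jet (m i) (f w w' i) ([w i] \<cdot> dB i \<oplus> [w' i] \<cdot> dA i)"
      unfolding f_def using diag[OF less.prems] by (intro log_jet_mult[OF mi] log_jet_pow[OF mi]) auto
    moreover have "log_jet (m i) (\<Otimes>j\<in>{i<..n}. f w w' j) \<zero>"
    proof (rule log_jet_finprod_zero[OF mi])
      fix j assume j: "j \<in> {i<..n}"
      have "log_jet (m i) (f w w' j) ([w j] \<cdot> \<zero> \<oplus> [w' j] \<cdot> \<zero>)"
        unfolding f_def using above[OF less.prems, of j] j
        by (intro log_jet_mult[OF mi] log_jet_pow[OF mi]) auto
      then show "log_jet (m i) (f w w' j) \<zero>" by simp
    qed simp
    ultimately have "log_jet (m i) (tail w w') (([w i] \<cdot> dB i \<oplus> [w' i] \<cdot> dA i) \<oplus> \<zero>)"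
      unfolding tail_def by (rule log_jet_mult[OF mi])
    then show ?thesis
      using diag[OF less.prems] by (simp add: log_jet_def F_carrier)
  qed
  have "tail u v = tail v u"
  proof -
    have "(\<Otimes>j\<in>{1..<i}. f v u j) \<otimes> tail u v = (\<Otimes>j\<in>{1..<i}. f v u j) \<otimes> tail v u"
      proof -
      have "(\<Otimes>j\<in>{1..n}. f u v j) = (\<Otimes>j\<in>{1..n}. f v u j)"
        using eq by (simp add: f_def)
      then show ?thesis
        unfolding split head_eq .
    qed
    then show ?thesis
      using head_nz m_lcancel f_cl[OF S(2)] log_jet_carrier[OF tail_jet] by auto
  qed
  then have "[u i] \<cdot> dB i \<oplus> [v i] \<cdot> dA i = [v i] \<cdot> dB i \<oplus> [u i] \<cdot> dA i"
    using log_jet_unique[OF m[OF less.prems]] tail_jet by metis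
  then show ?case
    using add_pow_exchange_imp_eq[OF p char, of "dB i" "dA i" "u i" "v i"]
      diag[OF less.prems] uv[OF less.prems] by (auto simp: log_jet_def F_carrier)
qed

end

section \<open>Polynomials and their quotients over a finite field\<close>

text \<open>With the leading coefficient first, multiplying by \<open>X\<close> appends a zero to
  the list. A non-empty list thereby gets positive degree, so only zero can be both a multiple of
  \<open>X\<close> and a constant.\<close>

lemma (in field) poly_ring_is_poly_like:
  "poly_like (poly_ring R) (poly_of_const ` carrier R) X"
proof -
  interpret UP: domain "poly_ring R"
    using univ_poly_is_domain[OF carrier_is_subring] .
  note X = var_closed(1)[OF carrier_is_subring]
  show ?thesis
  proof (intro poly_like.intro poly_like_axioms.intro)
    show "domain (poly_ring R)" by unfold_locales
    show "subfield (poly_of_const ` carrier R) (poly_ring R)"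
      by (rule univ_poly_carrier_subfield_of_consts)
    show "X \<in> carrier (poly_ring R)" by (rule X)
    show "X \<noteq> \<zero>\<^bsub>poly_ring R\<^esub>" by (simp add: var_def univ_poly_zero)
    fix z assume z: "z \<in> carrier (poly_ring R)" "X \<otimes>\<^bsub>poly_ring R\<^esub> z \<in> poly_of_const ` carrier R"
    have "degree (X \<otimes>\<^bsub>poly_ring R\<^esub> z) = 0"
      using z(2) unfolding poly_of_const_over_carrier by simp
    moreover have "X \<otimes>\<^bsub>poly_ring R\<^esub> z = (if z = [] then [] else z @ [\<zero>])"
      using poly_mult_var[OF carrier_is_subring z(1)] UP.m_comm[OF X z(1)] by simp
    ultimately show "X \<otimes>\<^bsub>poly_ring R\<^esub> z = \<zero>\<^bsub>poly_ring R\<^esub>"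
      by (auto simp: univ_poly_zero split: if_splits)
  qed
qed

text \<open>The zero polynomial has degree 0 here; as an inequality the rule also covers zero
  factors.\<close>

lemma (in domain) degree_mult_le:
  assumes "p \<in> carrier (poly_ring R)" "q \<in> carrier (poly_ring R)"
  shows "degree (p \<otimes>\<^bsub>poly_ring R\<^esub> q) \<le> degree p + degree q"
  using poly_mult_degree_eq[OF carrier_is_subring, of p q] assms
  by (auto simp: univ_poly_mult univ_poly_carrier)

lemma (in domain) degree_finprod_le:
  assumes "finite S" "\<And>j. j \<in> S \<Longrightarrow> P j \<in> carrier (poly_ring R)"
  shows "degree (\<Otimes>\<^bsub>poly_ring R\<^esub>j\<in>S. P j) \<le> (\<Sum>j\<in>S. degree (P j))"
proof -
  interpret UP: domain "poly_ring R"
    using univ_poly_is_domain[OF carrier_is_subring] .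
  show ?thesis
    using assms
  proof (induction S)
    case empty
    then show ?case by (simp add: univ_poly_one)
  next
    case (insert j S)
    then have cl: "P \<in> S \<rightarrow> carrier (poly_ring R)" "P j \<in> carrier (poly_ring R)" by auto
    have "degree (P j \<otimes>\<^bsub>poly_ring R\<^esub> (\<Otimes>\<^bsub>poly_ring R\<^esub>j\<in>S. P j))
        \<le> degree (P j) + degree (\<Otimes>\<^bsub>poly_ring R\<^esub>j\<in>S. P j)"
      using cl by (intro degree_mult_le UP.finprod_closed) auto
    also have "\<dots> \<le> degree (P j) + (\<Sum>j\<in>S. degree (P j))"
      using insert by simp
    finally show ?case
      using insert cl by simp
  qed
qed

lemma (in field) degree_linear_le:
  assumes "b \<in> poly_of_const ` carrier R" "c \<in> poly_of_const ` carrier R"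
  shows "degree (b \<otimes>\<^bsub>poly_ring R\<^esub> X [^]\<^bsub>poly_ring R\<^esub> j \<oplus>\<^bsub>poly_ring R\<^esub> c) \<le> j"
proof -
  have cl: "b \<in> carrier (poly_ring R)" "c \<in> carrier (poly_ring R)" "degree b = 0" "degree c = 0"
    using assms unfolding poly_of_const_over_carrier by auto
  have "degree (X [^]\<^bsub>poly_ring R\<^esub> j) = j"
    using polynomial_pow_degree[OF var_closed(1)[OF carrier_is_subring]] by (simp add: var_def)
  then have "degree (b \<otimes>\<^bsub>poly_ring R\<^esub> X [^]\<^bsub>poly_ring R\<^esub> j) \<le> j"
    using degree_mult_le[OF cl(1) var_pow_closed[OF carrier_is_subring], of j] cl by simp
  then show ?thesis
    using poly_add_degree[of "b \<otimes>\<^bsub>poly_ring R\<^esub> X [^]\<^bsub>poly_ring R\<^esub> j" c] cl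
    by (simp add: univ_poly_add)
qed

text \<open>Both polynomials are their own remainders modulo \<open>p\<close>, and the quotient map
  is injective on remainders.\<close>

lemma (in field) rupture_surj_eq_imp_eq:
  assumes "p \<in> carrier (poly_ring R)" "a \<in> carrier (poly_ring R)" "b \<in> carrier (poly_ring R)"
    and "degree a < degree p" "degree b < degree p"
    and "rupture_surj (carrier R) p a = rupture_surj (carrier R) p b"
  shows "a = b"
proof -
  have "a pmod p = a" "b pmod p = b"
    using assms by (auto intro!: pmod_const(2)[OF carrier_is_subfield])
  then have "a \<in> (\<lambda>q. q pmod p) ` carrier (poly_ring R)" "b \<in> (\<lambda>q. q pmod p) ` carrier (poly_ring R)"
    using assms by (metis imageI)+
  then show ?thesis
    using rupture_surj_inj_on[OF carrier_is_subfield assms(1)] assms(6) by (auto dest: inj_onD)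
qed

text \<open>Stripping leading zeros is a bijection from the lists of length exactly
  \<open>d\<close>; its inverse pads with zeros.\<close>

lemma (in ring) card_bounded_length_polynomials:
  assumes "finite (carrier R)"
  shows "card {p \<in> carrier (poly_ring R). length p \<le> d} = card (carrier R) ^ d"
proof -
  let ?L = "{xs. set xs \<subseteq> carrier R \<and> length xs = d}"
  have "bij_betw normalize ?L {p \<in> carrier (poly_ring R). length p \<le> d}"
    unfolding bij_betw_def
  proof (intro conjI inj_onI equalityI subsetI)
    fix xs ys assume "xs \<in> ?L" "ys \<in> ?L" "normalize xs = normalize ys"
    then show "xs = ys"
      using normalize_trick[of xs] normalize_trick[of ys] by simp
  next
    fix p assume "p \<in> normalize ` ?L"
    then show "p \<in> {p \<in> carrier (poly_ring R). length p \<le> d}"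
      using normalize_gives_polynomial normalize_length_le by (force simp: univ_poly_carrier)
  next
    fix p assume p: "p \<in> {p \<in> carrier (poly_ring R). length p \<le> d}"
    then have "polynomial (carrier R) p"
      by (simp add: univ_poly_carrier)
    then have "set p \<subseteq> carrier R" "normalize (replicate (d - length p) \<zero> @ p) = p"
      by (simp_all add: polynomial_incl normalize_replicate_zero normalize_polynomial)
    then show "p \<in> normalize ` ?L"
      using p by (intro image_eqI[of _ _ "replicate (d - length p) \<zero> @ p"]) auto
  qed
  then show ?thesis
    using card_lists_length_eq[OF assms, of d] bij_betw_same_card by force
qed

lemma (in field) card_rupture:
  assumes "finite (carrier R)" "p \<in> carrier (poly_ring R)" "p \<noteq> []"
  shows "card (carrier (Rupt (carrier R) p)) = card (carrier R) ^ degree p"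
proof -
  let ?S = "{q \<in> carrier (poly_ring R). length q \<le> degree p}"
  have "bij_betw (rupture_surj (carrier R) p) ?S (carrier (Rupt (carrier R) p))"
    using rupture_surj_inj_on[OF carrier_is_subfield assms(2)]
      rupture_carrier_as_pmod_image[OF carrier_is_subfield assms(2)]
    unfolding pmod_image_characterization[OF carrier_is_subfield assms(2,3)] bij_betw_def by blast
  then have "card (carrier (Rupt (carrier R) p)) = card ?S"
    by (rule bij_betw_same_card[symmetric])
  then show ?thesis
    unfolding card_bounded_length_polynomials[OF assms(1)] .
qed

text \<open>The zero of the quotient is the ideal itself, and a coset equals the ideal exactly when
  its representative lies in it.\<close>

lemma (in domain) rupture_surj_eq_zero_iff:
  assumes "p \<in> carrier (poly_ring R)" "a \<in> carrier (poly_ring R)"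
  shows "rupture_surj (carrier R) p a = \<zero>\<^bsub>Rupt (carrier R) p\<^esub> \<longleftrightarrow> p divides\<^bsub>poly_ring R\<^esub> a"
proof -
  interpret UP: domain "poly_ring R"
    using univ_poly_is_domain[OF carrier_is_subring] .
  note I = UP.cgenideal_ideal[OF assms(1)]
  have "rupture_surj (carrier R) p a = \<zero>\<^bsub>Rupt (carrier R) p\<^esub> \<longleftrightarrow> a \<in> PIdl\<^bsub>poly_ring R\<^esub> p"
    unfolding rupture_def FactRing_def
    using ideal.rcos_const_imp_mem[OF I assms(2)]
      abelian_subgroup.a_rcos_const[OF abelian_subgroupI3[OF ideal.axioms(1)[OF I] UP.abelian_group_axioms]]
    by auto
  also have "\<dots> \<longleftrightarrow> p divides\<^bsub>poly_ring R\<^esub> a"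
    using assms by (auto simp: cgenideal_def factor_def UP.m_comm)
  finally show ?thesis .
qed

section \<open>The polynomial of ones and its irreducibility\<close>

lemma (in domain) cyclo_poly_closed [simp]: "cyclo_poly R n \<in> carrier (poly_ring R)"
  by (cases n) (auto simp: cyclo_poly_def univ_poly_carrier[symmetric] polynomial_def)

lemma (in domain) var_pow_add_cyclo_poly:
  "X [^]\<^bsub>poly_ring R\<^esub> n \<oplus>\<^bsub>poly_ring R\<^esub> cyclo_poly R n = cyclo_poly R (Suc n)"
  using poly_add_monom[of "cyclo_poly R n" \<one>]
  by (simp add: unitary_monom_eq_var_pow[OF carrier_is_subring, symmetric] univ_poly_add
      cyclo_poly_def set_replicate_conv_if)

text \<open>Here a one is appended at the constant end, in \<open>var_pow_add_cyclo_poly\<close> at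
  the leading end. Equating the two replaces the identity
  \<open>(x - 1) (x^(n-1) + ... + 1) = x^n - 1\<close>.\<close>

lemma (in domain) cyclo_poly_mult_var_add_one:
  "cyclo_poly R n \<otimes>\<^bsub>poly_ring R\<^esub> X \<oplus>\<^bsub>poly_ring R\<^esub> \<one>\<^bsub>poly_ring R\<^esub> = cyclo_poly R (Suc n)"
proof (induction n)
  case 0
  interpret UP: domain "poly_ring R"
    using univ_poly_is_domain[OF carrier_is_subring] .
  have "cyclo_poly R 0 = \<zero>\<^bsub>poly_ring R\<^esub>" "cyclo_poly R (Suc 0) = \<one>\<^bsub>poly_ring R\<^esub>"
    by (simp_all add: cyclo_poly_def univ_poly_zero univ_poly_one)
  then show ?case
    using var_closed(1)[OF carrier_is_subring] by simp
next
  case (Suc n)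
  interpret UP: domain "poly_ring R"
    using univ_poly_is_domain[OF carrier_is_subring] .
  note X = var_closed(1)[OF carrier_is_subring]
  have "cyclo_poly R (Suc n) \<otimes>\<^bsub>poly_ring R\<^esub> X \<oplus>\<^bsub>poly_ring R\<^esub> \<one>\<^bsub>poly_ring R\<^esub>
      = X [^]\<^bsub>poly_ring R\<^esub> Suc n \<oplus>\<^bsub>poly_ring R\<^esub> (cyclo_poly R n \<otimes>\<^bsub>poly_ring R\<^esub> X \<oplus>\<^bsub>poly_ring R\<^esub> \<one>\<^bsub>poly_ring R\<^esub>)"
    using X by (simp add: var_pow_add_cyclo_poly[of n, symmetric] UP.l_distr UP.a_assoc)
  then show ?case
    unfolding Suc var_pow_add_cyclo_poly .
qed

lemma (in domain) hom_var_pow_eq_one: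
  assumes L: "domain L" and h: "h \<in> ring_hom (poly_ring R) L" and zero: "h (cyclo_poly R n) = \<zero>\<^bsub>L\<^esub>"
  shows "h X [^]\<^bsub>L\<^esub> n = \<one>\<^bsub>L\<^esub>"
proof -
  interpret UP: domain "poly_ring R"
    using univ_poly_is_domain[OF carrier_is_subring] .
  interpret L: domain L by (rule L)
  interpret h: ring_hom_cring "poly_ring R" L h
    using h by unfold_locales
  note X = var_closed(1)[OF carrier_is_subring]
  have "h (X [^]\<^bsub>poly_ring R\<^esub> n \<oplus>\<^bsub>poly_ring R\<^esub> cyclo_poly R n)
      = h (cyclo_poly R n \<otimes>\<^bsub>poly_ring R\<^esub> X \<oplus>\<^bsub>poly_ring R\<^esub> \<one>\<^bsub>poly_ring R\<^esub>)"
    by (simp only: var_pow_add_cyclo_poly cyclo_poly_mult_var_add_one)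
  then show ?thesis
    using X zero by simp
qed

text \<open>Used to rule out 1 as a root: the value there is \<open>n\<close>, which does not vanish
  when the characteristic is prime to \<open>n\<close>.\<close>

lemma (in domain) hom_cyclo_poly_at_one:
  assumes L: "domain L" and h: "h \<in> ring_hom (poly_ring R) L" and one: "h X = \<one>\<^bsub>L\<^esub>"
  shows "h (cyclo_poly R n) = add_pow L n \<one>\<^bsub>L\<^esub>"
proof -
  interpret UP: domain "poly_ring R"
    using univ_poly_is_domain[OF carrier_is_subring] .
  interpret L: domain L by (rule L)
  interpret h: ring_hom_cring "poly_ring R" L h
    using h by unfold_locales
  note X = var_closed(1)[OF carrier_is_subring]
  show ?thesis
  proof (induction n)
    case 0
    have "cyclo_poly R 0 = \<zero>\<^bsub>poly_ring R\<^esub>"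
      by (simp add: cyclo_poly_def univ_poly_zero)
    then show ?case by simp
  next
    case (Suc n)
    then show ?case
      using X one by (simp add: var_pow_add_cyclo_poly[of n, symmetric] L.a_comm)
  qed
qed

lemma (in ring_hom_ring) hom_add_pow:
  "x \<in> carrier R \<Longrightarrow> h (add_pow R (n :: nat) x) = add_pow S n (h x)"
  by (induction n) simp_all

lemma (in domain) char_hom:
  assumes L: "domain L" and h: "h \<in> ring_hom (poly_ring R) L" and char: "add_pow R (p :: nat) \<one> = \<zero>"
  shows "add_pow L p \<one>\<^bsub>L\<^esub> = \<zero>\<^bsub>L\<^esub>"
proof -
  interpret UP: domain "poly_ring R"
    using univ_poly_is_domain[OF carrier_is_subring] .
  interpret L: domain L by (rule L)
  interpret h: ring_hom_ring "poly_ring R" L h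
    using h by unfold_locales
  interpret c: ring_hom_ring R "poly_ring R" poly_of_const
    using canonical_embedding_ring_hom[OF carrier_is_subring] by simp
  have "h (poly_of_const (add_pow R p \<one>)) = add_pow L p \<one>\<^bsub>L\<^esub>"
    using c.hom_add_pow[of \<one> p] h.hom_add_pow[of "\<one>\<^bsub>poly_ring R\<^esub>" p] by simp
  then show ?thesis using char by simp
qed

text \<open>The order of \<open>x\<close> is exactly the prime \<open>r\<close>, and it divides the
  order of the multiplicative group.\<close>

lemma (in field) prime_order_dvd_card:
  fixes r :: nat
  assumes "finite (carrier R)" "Factorial_Ring.prime r" "x \<in> carrier R" "x \<noteq> \<one>" "x [^] r = \<one>"
  shows "r dvd card (carrier R) - 1"
proof -
  interpret G: group "Multiplicative_Group.mult_of R" by (rule field_mult_group)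
  have "x \<noteq> \<zero>"
    using assms(2,5) prime_gt_0_nat[of r] by (auto simp: nat_pow_zero)
  then have x: "x \<in> carrier (Multiplicative_Group.mult_of R)" using assms(3) by simp
  have "G.ord x dvd r"
    using assms(5) G.pow_eq_id[OF x, of r] by (simp add: Multiplicative_Group.nat_pow_mult_of)
  moreover have "G.ord x \<noteq> 1"
    using G.ord_eq_1[OF x] assms(4) by simp
  ultimately have "G.ord x = r"
    using assms(2) prime_nat_iff by blast
  then show ?thesis
    using G.ord_dvd_group_order[OF x] order_mult_of[OF assms(1)] by (simp add: order_def)
qed

text \<open>Adjoining a root of an irreducible factor \<open>P\<close> gives a field with
  \<open>q ^ degree P\<close> elements that contains an element of order \<open>r\<close>. So
  \<open>r\<close> divides \<open>q ^ degree P - 1\<close>, and the order \<open>r - 1\<close> of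
  \<open>q\<close> divides \<open>degree P\<close>: every irreducible factor has full
  degree.\<close>

lemma (in field) cyclo_poly_irreducible:
  fixes p k r :: nat
  assumes p: "Factorial_Ring.prime p" and fin: "finite (carrier R)" and card: "card (carrier R) = p ^ k"
    and r: "Factorial_Ring.prime r" and "coprime r (p ^ k)" and ord: "ord r (p ^ k) = r - 1" and "k \<ge> 1"
  shows "pirreducible (carrier R) (cyclo_poly R r)"
proof -
  interpret UP: principal_domain "poly_ring R"
    using univ_poly_is_principal[OF carrier_is_subfield] .
  define q where "q = p ^ k"
  have r2: "r \<ge> 2" using r by (rule prime_ge_2_nat)
  have deg: "degree (cyclo_poly R r) = r - 1" "cyclo_poly R r \<noteq> []"
    using r2 by (auto simp: cyclo_poly_def)
  have char: "[p] \<cdot> \<one> = \<zero>" by (rule finite_field_char[OF fin card])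
  have large: "degree P \<ge> r - 1"
    if P: "P \<in> carrier (poly_ring R)" "pirreducible (carrier R) P" "P divides\<^bsub>poly_ring R\<^esub> cyclo_poly R r" for P
  proof -
    let ?L = "Rupt (carrier R) P" and ?h = "rupture_surj (carrier R) P"
    interpret L: field ?L
      using rupture_is_field_iff_pirreducible[OF carrier_is_subfield P(1)] P(2) by blast
    have h: "?h \<in> ring_hom (poly_ring R) ?L"
      by (rule rupture_surj_hom(1)[OF carrier_is_subring P(1)])
    have zero: "?h (cyclo_poly R r) = \<zero>\<^bsub>?L\<^esub>"
      using rupture_surj_eq_zero_iff[OF P(1)] P(3) by simp
    have card_L: "card (carrier ?L) = q ^ degree P"
      using card_rupture[OF fin P(1)] pirreducibleE(1)[OF carrier_is_subring P(1,2)] card by (simp add: q_def)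
    have q0: "q > 0" using p by (simp add: q_def prime_gt_0_nat)
    have fin_L: "finite (carrier ?L)"
      using card_L q0 by (intro card_ge_0_finite) simp
    \<comment> \<open>If the root were 1, then \<open>r\<close> would be zero in characteristic
      \<open>p\<close>, forcing \<open>p = r\<close> against coprimality.\<close>
    have "?h X \<noteq> \<one>\<^bsub>?L\<^esub>"
    proof
      assume "?h X = \<one>\<^bsub>?L\<^esub>"
      then have "add_pow ?L r \<one>\<^bsub>?L\<^esub> = \<zero>\<^bsub>?L\<^esub>"
        using hom_cyclo_poly_at_one[OF L.domain_axioms h, of r] zero by simp
      then have "p dvd r"
        using L.add_pow_eq_zero_dvd[OF p char_hom[OF L.domain_axioms h char], of "\<one>\<^bsub>?L\<^esub>" r] by simp
      then show False
        using p r \<open>coprime r (p ^ k)\<close> \<open>k \<ge> 1\<close> by (auto dest: primes_dvd_imp_eq)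
    qed
    then have "r dvd q ^ degree P - 1"
      using L.prime_order_dvd_card[OF fin_L r _ _ hom_var_pow_eq_one[OF L.domain_axioms h zero]]
        ring_hom_closed[OF h var_closed(1)[OF carrier_is_subring]] card_L by simp
    then have "[q ^ degree P = 1] (mod r)"
      using q0 by (subst cong_altdef_nat) (auto simp: Suc_le_eq)
    then have "r - 1 dvd degree P"
      using ord ord_divides[of q "degree P" r] by (simp add: q_def)
    then show ?thesis
      using pirreducible_degree[OF carrier_is_subfield P(1,2)] by (auto dest: dvd_imp_le)
  qed
  have nonunit_degree: "degree A \<ge> 1" if A: "A \<in> carrier (poly_ring R)" "A \<noteq> []" "A \<notin> Units (poly_ring R)" for A
  proof (rule ccontr)
    assume "\<not> degree A \<ge> 1"
    then obtain a where "A = [a]" using A(2) by (cases A) (auto simp: Suc_le_eq)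
    then show False
      using A univ_poly_units[OF carrier_is_subfield] by (auto simp: univ_poly_carrier[symmetric] polynomial_def)
  qed
  show ?thesis
  proof (rule pirreducibleI[OF carrier_is_subring])
    show "cyclo_poly R r \<notin> Units (poly_ring R)"
    proof
      assume "cyclo_poly R r \<in> Units (poly_ring R)"
      then obtain a where "cyclo_poly R r = [a]"
        unfolding univ_poly_units[OF carrier_is_subfield] by blast
      then show False using deg(1) r2 by simp
    qed
    fix A B assume AB: "A \<in> carrier (poly_ring R)" "B \<in> carrier (poly_ring R)"
      "cyclo_poly R r = A \<otimes>\<^bsub>poly_ring R\<^esub> B"
    show "A \<in> Units (poly_ring R) \<or> B \<in> Units (poly_ring R)"
    proof (rule ccontr)
      assume nonunits: "\<not> ?thesis"
      have ne: "A \<noteq> []" "B \<noteq> []"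
        using AB deg(2) UP.l_null UP.r_null by (auto simp: univ_poly_zero)
      have A: "A \<in> carrier (poly_ring R) - {\<zero>\<^bsub>poly_ring R\<^esub>}" "A \<notin> Units (poly_ring R)"
        using AB(1) ne(1) nonunits by (simp_all add: univ_poly_zero)
      obtain P where P: "P \<in> carrier (poly_ring R)" "pirreducible (carrier R) P" "P divides\<^bsub>poly_ring R\<^esub> A"
        by (rule UP.exists_irreducible_divisor[OF A])
      have "P divides\<^bsub>poly_ring R\<^esub> cyclo_poly R r"
        using P AB by (simp add: UP.divides_prod_r)
      from large[OF P(1,2) this] have "degree P \<ge> r - 1" .
      moreover have "degree P \<le> degree A"
        using pdivides_imp_degree_le[OF carrier_is_subring P(1) AB(1) ne(1)] P(3) by (simp add: pdivides_def)
      moreover have "degree A + degree B = r - 1"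
        using poly_mult_degree_eq[OF carrier_is_subring, of A B] AB ne deg
        by (simp add: univ_poly_mult univ_poly_carrier)
      \<comment> \<open>A divisor of \<open>A\<close> already takes up the full degree
        \<open>r - 1\<close>, which makes \<open>B\<close> a constant and hence a unit.\<close>
      ultimately show False
        using nonunit_degree[OF AB(2) ne(2)] nonunits by simp
    qed
  qed (simp_all add: deg)
qed

section \<open>Counting powers by partitions\<close>

lemma (in group) card_le_ord:
  assumes "finite (carrier G)" "x \<in> carrier G" "inj_on (\<lambda>u. x [^] (E u :: nat)) S"
  shows "card S \<le> ord x"
proof -
  have "(\<lambda>u. x [^] E u) ` S \<subseteq> (\<lambda>i. x [^] i) ` {0..ord x - 1}"
    using ord_elems[OF assms(1,2)] by blast
  then have "card ((\<lambda>u. x [^] E u) ` S) \<le> card {0..ord x - 1}"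
    by (meson card_image_le card_mono finite_atLeastAtMost finite_imageI le_trans)
  then show ?thesis
    using ord_ge_1[OF assms(1,2)] card_image[OF assms(3)] by simp
qed

abbreviation poly_log_jet :: "('a, 'b) ring_scheme \<Rightarrow> nat \<Rightarrow> 'a list \<Rightarrow> 'a list \<Rightarrow> bool" where
  "poly_log_jet K \<equiv> poly_like.log_jet (poly_ring K) (ring.poly_of_const K ` carrier K) X\<^bsub>K\<^esub>"

text \<open>
  \<open>h\<close> stands for evaluation at an element of \<open>L\<close> that is a root of no non-zero polynomial of degree
  less than \<open>N\<close>.
\<close>

locale faithful_evaluation = base: field K + field L
  for K :: "('a, 'b) ring_scheme" and L :: "('c, 'd) ring_scheme" (structure) +
  fixes h :: "'a list \<Rightarrow> 'c" and p N :: nat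
  assumes p_prime: "Factorial_Ring.prime p" and char_K: "add_pow K p \<one>\<^bsub>K\<^esub> = \<zero>\<^bsub>K\<^esub>"
    and finite_L: "finite (carrier L)" and h_hom: "h \<in> ring_hom (poly_ring K) L"
    and h_inj: "\<lbrakk>a \<in> carrier (poly_ring K); b \<in> carrier (poly_ring K); degree a < N; degree b < N; h a = h b\<rbrakk> \<Longrightarrow> a = b"

sublocale faithful_evaluation \<subseteq> UP: poly_like "poly_ring K" "base.poly_of_const ` carrier K" "X\<^bsub>K\<^esub>"
  by (rule base.poly_ring_is_poly_like)

sublocale faithful_evaluation \<subseteq> h: ring_hom_cring "poly_ring K" L h
  using h_hom by unfold_locales

sublocale faithful_evaluation \<subseteq> G: group "Multiplicative_Group.mult_of L"
  by (rule field_mult_group)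

context faithful_evaluation
begin

text \<open>Common core of all the counts. The hypothesis \<open>pow\<close> says that
  \<open>\<tau> [^] j\<close> times the value of \<open>B j / A j\<close> is a power of
  \<open>y\<close>, with the denominator multiplied out. Weighting by a partition \<open>u\<close>
  gives a power of \<open>y\<close> equal to \<open>\<tau> [^] n\<close> times the value of
  \<open>\<Prod>\<^sub>j (B j / A j)^(u j)\<close>. Equal powers give, after cross-multiplication,
  polynomials of degree at most \<open>(s + t) * n < N\<close> with equal values; these are equal as
  polynomials, and their jets determine \<open>u\<close>.\<close>

lemma U_part_le_ord:
  fixes n s t :: nat and m e :: "nat \<Rightarrow> nat"
  assumes
    nz: "\<And>j. j \<in> {1..n} \<Longrightarrow> A j \<in> carrier (poly_ring K) - {[]} \<and> B j \<in> carrier (poly_ring K) - {[]}"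
    and m: "\<And>j. j \<in> {1..n} \<Longrightarrow> m j \<ge> 1"
    and diag: "\<And>j. j \<in> {1..n} \<Longrightarrow> poly_log_jet K (m j) (A j) (dA j) \<and> poly_log_jet K (m j) (B j) (dB j) \<and> dA j \<noteq> dB j"
    and above: "\<And>i j. i \<in> {1..n} \<Longrightarrow> j \<in> {1..n} \<Longrightarrow> i < j \<Longrightarrow>
        poly_log_jet K (m i) (A j) [] \<and> poly_log_jet K (m i) (B j) []"
    and deg: "\<And>j. j \<in> {1..n} \<Longrightarrow> degree (B j) \<le> s * j \<and> degree (A j) \<le> t * j" "(s + t) * n < N"
    and y: "y \<in> carrier L - {\<zero>}" and \<tau>: "\<tau> \<in> carrier L - {\<zero>}"
    and pow: "\<And>j. j \<in> {1..n} \<Longrightarrow> y [^] e j \<otimes> h (A j) = \<tau> [^] j \<otimes> h (B j)"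
  shows "U_part n (p - 1) \<le> G.ord y"
proof -
  \<comment> \<open>The identity homomorphism transfers the characteristic to the polynomial
    ring.\<close>
  have char_UP: "add_pow (poly_ring K) p \<one>\<^bsub>poly_ring K\<^esub> = \<zero>\<^bsub>poly_ring K\<^esub>"
    by (rule base.char_hom[where h = "\<lambda>x. x"]) (use char_K UP.domain_axioms in \<open>auto intro!: ring_hom_memI\<close>)
  define S where "S = {u \<in> {1..n} \<rightarrow>\<^sub>E {..p - 1}. (\<Sum>j = 1..n. j * u j) = n}"
  define E where "E u = (\<Sum>j = 1..n. e j * u j)" for u :: "nat \<Rightarrow> nat"
  define PA PB where "PA u T = (\<Otimes>\<^bsub>poly_ring K\<^esub>j\<in>T. A j [^]\<^bsub>poly_ring K\<^esub> u j)"
    and "PB u T = (\<Otimes>\<^bsub>poly_ring K\<^esub>j\<in>T. B j [^]\<^bsub>poly_ring K\<^esub> u j)" for u :: "nat \<Rightarrow> nat" and T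
  have AB_cl: "A j \<in> carrier (poly_ring K)" "B j \<in> carrier (poly_ring K)" if "j \<in> {1..n}" for j
    using nz[OF that] by auto
  have fun_cl: "(\<lambda>j. A j [^]\<^bsub>poly_ring K\<^esub> (u j :: nat)) \<in> T \<rightarrow> carrier (poly_ring K)"
      "(\<lambda>j. B j [^]\<^bsub>poly_ring K\<^esub> (u j :: nat)) \<in> T \<rightarrow> carrier (poly_ring K)" if "T \<subseteq> {1..n}" for u T
    unfolding Pi_def using that by (auto simp only: mem_Collect_eq intro!: UP.nat_pow_closed AB_cl)
  have P_cl: "PA u T \<in> carrier (poly_ring K)" "PB u T \<in> carrier (poly_ring K)" if "T \<subseteq> {1..n}" for u T
    unfolding PA_def PB_def using fun_cl[OF that] by (auto intro!: UP.finprod_closed)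
  have y_cl: "y \<in> carrier L" and \<tau>_cl: "\<tau> \<in> carrier L" using y \<tau> by auto
  have prod: "y [^] (\<Sum>j\<in>T. e j * u j) \<otimes> h (PA u T) = \<tau> [^] (\<Sum>j\<in>T. j * u j) \<otimes> h (PB u T)"
    if "T \<subseteq> {1..n}" for u T
    using finite_subset[OF that finite_atLeastAtMost] that
  proof (induction T)
    case empty
    then show ?case by (simp add: PA_def PB_def)
  next
    case (insert j T)
    have j: "j \<in> {1..n}" and T: "T \<subseteq> {1..n}" using insert by auto
    have step: "PA u (insert j T) = A j [^]\<^bsub>poly_ring K\<^esub> u j \<otimes>\<^bsub>poly_ring K\<^esub> PA u T"
        "PB u (insert j T) = B j [^]\<^bsub>poly_ring K\<^esub> u j \<otimes>\<^bsub>poly_ring K\<^esub> PB u T"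
      unfolding PA_def PB_def using insert fun_cl[OF T] AB_cl[OF j] by auto
    have cl: "h (A j) \<in> carrier L" "h (B j) \<in> carrier L" "h (PA u T) \<in> carrier L" "h (PB u T) \<in> carrier L"
      using AB_cl[OF j] P_cl[OF T] by auto
    have "y [^] (\<Sum>j\<in>insert j T. e j * u j) \<otimes> h (PA u (insert j T))
        = (y [^] e j \<otimes> h (A j)) [^] u j \<otimes> (y [^] (\<Sum>j\<in>T. e j * u j) \<otimes> h (PA u T))"
      using insert.hyps cl y_cl AB_cl[OF j] P_cl[OF T]
      by (simp add: step nat_pow_mult[symmetric] nat_pow_distrib nat_pow_pow m_ac)
    also have "\<dots> = (\<tau> [^] j \<otimes> h (B j)) [^] u j \<otimes> (\<tau> [^] (\<Sum>j\<in>T. j * u j) \<otimes> h (PB u T))"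
      using insert.IH[OF T] pow[OF j] by simp
    also have "\<dots> = \<tau> [^] (\<Sum>j\<in>insert j T. j * u j) \<otimes> h (PB u (insert j T))"
      using insert.hyps cl \<tau>_cl AB_cl[OF j] P_cl[OF T]
      by (simp add: step nat_pow_mult[symmetric] nat_pow_distrib nat_pow_pow m_ac)
    finally show ?case .
  qed
  have "inj_on (\<lambda>u. y [^]\<^bsub>Multiplicative_Group.mult_of L\<^esub> E u) S"
  proof (rule inj_onI)
    fix u v assume u: "u \<in> S" and v: "v \<in> S"
      and "y [^]\<^bsub>Multiplicative_Group.mult_of L\<^esub> E u = y [^]\<^bsub>Multiplicative_Group.mult_of L\<^esub> E v"
    then have E_eq: "y [^] E u = y [^] E v"
      by (simp add: Multiplicative_Group.nat_pow_mult_of)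
    let ?I = "{1..n}"
    have cl: "h (PA w ?I) \<in> carrier L" "h (PB w ?I) \<in> carrier L" for w
      using P_cl[of ?I w] by auto
    \<comment> \<open>The parts of \<open>w\<close> sum to \<open>n\<close>, so the power of
      \<open>\<tau>\<close> is the same for all partitions and can be cancelled below.\<close>
    have prod_w: "y [^] E w \<otimes> h (PA w ?I) = \<tau> [^] n \<otimes> h (PB w ?I)" if "w \<in> S" for w
      using prod[of ?I w] that by (simp add: E_def S_def)
    have "\<tau> [^] n \<otimes> (h (PB u ?I) \<otimes> h (PA v ?I)) = y [^] E u \<otimes> h (PA u ?I) \<otimes> h (PA v ?I)"
      unfolding prod_w[OF u] using cl \<tau>_cl by (simp add: m_assoc)
    also have "\<dots> = y [^] E v \<otimes> h (PA v ?I) \<otimes> h (PA u ?I)"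
      unfolding E_eq using cl y_cl by (simp add: m_ac)
    also have "\<dots> = \<tau> [^] n \<otimes> (h (PB v ?I) \<otimes> h (PA u ?I))"
      unfolding prod_w[OF v] using cl \<tau>_cl by (simp add: m_assoc)
    finally have "h (PB u ?I) \<otimes> h (PA v ?I) = h (PB v ?I) \<otimes> h (PA u ?I)"
      using m_lcancel[of "\<tau> [^] n"] nat_pow_nonzero[of \<tau>] \<tau> cl by simp
    then have h_eq: "h (PB u ?I \<otimes>\<^bsub>poly_ring K\<^esub> PA v ?I) = h (PB v ?I \<otimes>\<^bsub>poly_ring K\<^esub> PA u ?I)"
      using P_cl[of ?I] by simp
    have deg_le: "degree (PB w ?I \<otimes>\<^bsub>poly_ring K\<^esub> PA w' ?I) < N" if w: "w \<in> S" "w' \<in> S" for w w'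
    proof -
      have "degree (PB w ?I) \<le> (\<Sum>j\<in>?I. degree (B j [^]\<^bsub>poly_ring K\<^esub> w j))"
        unfolding PB_def using AB_cl by (intro base.degree_finprod_le UP.nat_pow_closed) auto
      also have "\<dots> = (\<Sum>j\<in>?I. w j * degree (B j))"
        by (intro sum.cong refl base.polynomial_pow_degree AB_cl)
      also have "\<dots> \<le> (\<Sum>j\<in>?I. w j * (s * j))"
        using deg(1) by (intro sum_mono mult_le_mono) auto
      also have "\<dots> = s * (\<Sum>j\<in>?I. j * w j)"
        by (simp add: sum_distrib_left ac_simps)
      also have "\<dots> = s * n"
        using w(1) by (simp add: S_def)
      finally have 1: "degree (PB w ?I) \<le> s * n" .
      have "degree (PA w' ?I) \<le> (\<Sum>j\<in>?I. degree (A j [^]\<^bsub>poly_ring K\<^esub> w' j))"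
        unfolding PA_def using AB_cl by (intro base.degree_finprod_le UP.nat_pow_closed) auto
      also have "\<dots> = (\<Sum>j\<in>?I. w' j * degree (A j))"
        by (intro sum.cong refl base.polynomial_pow_degree AB_cl)
      also have "\<dots> \<le> (\<Sum>j\<in>?I. w' j * (t * j))"
        using deg(1) by (intro sum_mono mult_le_mono) auto
      also have "\<dots> = t * (\<Sum>j\<in>?I. j * w' j)"
        by (simp add: sum_distrib_left ac_simps)
      also have "\<dots> = t * n"
        using w(2) by (simp add: S_def)
      finally have 2: "degree (PA w' ?I) \<le> t * n" .
      have "degree (PB w ?I \<otimes>\<^bsub>poly_ring K\<^esub> PA w' ?I) \<le> degree (PB w ?I) + degree (PA w' ?I)"
        using P_cl[of ?I] by (intro base.degree_mult_le) auto
      with 1 2 have "degree (PB w ?I \<otimes>\<^bsub>poly_ring K\<^esub> PA w' ?I) \<le> s * n + t * n"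
        by linarith
      then show ?thesis
        using deg(2) by (simp add: distrib_right)
    qed
    have "PB u ?I \<otimes>\<^bsub>poly_ring K\<^esub> PA v ?I = PB v ?I \<otimes>\<^bsub>poly_ring K\<^esub> PA u ?I"
      using P_cl[of ?I] by (intro h_inj deg_le h_eq u v UP.m_closed) auto
    then have eq: "(\<Otimes>\<^bsub>poly_ring K\<^esub>j\<in>?I. B j [^]\<^bsub>poly_ring K\<^esub> u j \<otimes>\<^bsub>poly_ring K\<^esub> A j [^]\<^bsub>poly_ring K\<^esub> v j)
        = (\<Otimes>\<^bsub>poly_ring K\<^esub>j\<in>?I. B j [^]\<^bsub>poly_ring K\<^esub> v j \<otimes>\<^bsub>poly_ring K\<^esub> A j [^]\<^bsub>poly_ring K\<^esub> u j)"
      unfolding PA_def PB_def using fun_cl[of ?I] by (subst (1 2) UP.finprod_multf) auto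
    have bound: "w j < p" if "w \<in> S" "j \<in> ?I" for w j
    proof -
      have "w j \<le> p - 1" using that by (auto simp: S_def PiE_iff)
      then show ?thesis using prime_gt_0_nat[OF p_prime] by linarith
    qed
    have "u j = v j" if j: "j \<in> ?I" for j
      by (rule UP.log_jet_pairs_unique[where A = A and B = B and m = m and dA = dA and dB = dB,
            OF p_prime char_UP _ m diag _ _ eq j])
        (use nz above bound u v in \<open>auto simp: univ_poly_zero\<close>)
    then show "u = v"
      using u v by (intro PiE_ext[of u ?I "\<lambda>_. {..p - 1}" v]) (auto simp: S_def)
  qed
  then have "card S \<le> G.ord y"
    using y finite_L by (intro G.card_le_ord) auto
  then show ?thesis
    by (simp add: U_part_def S_def)
qed

end

section \<open>Conjugates of the element\<close>

text \<open>Let \<open>n = ord x\<close> and let \<open>u\<close>, \<open>v\<close> be the orders of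
  the two powers. Then \<open>u = n / gcd n A\<close> is coprime to \<open>A / gcd n A\<close>, so
  \<open>n dvd A * B\<close> yields \<open>u dvd B\<close>. Thus \<open>u\<close> divides
  \<open>gcd n B = n / v\<close>, whence \<open>u * v \<le> n\<close>.\<close>

lemma (in group) ord_pow_mult_ord_pow_le:
  fixes A B :: nat
  assumes x: "x \<in> carrier G" and "x [^] (A * B) = \<one>" "A > 0" "B > 0"
  shows "ord (x [^] A) * ord (x [^] B) \<le> ord x"
proof -
  define n where "n = ord x"
  have dvd: "n dvd A * B" using assms pow_eq_id[OF x] by (simp add: n_def)
  then have n0: "n > 0" using assms by (auto intro: Nat.gr0I)
  have ords: "ord (x [^] A) = n div gcd n A" "ord (x [^] B) = n div gcd n B"
    using ord_pow_gen[OF x] assms by (simp_all add: n_def)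
  define g g' where "g = gcd n A" and "g' = gcd n B"
  obtain u where u: "n = g * u" by (metis g_def gcd_dvd1 dvdE)
  obtain v where v: "n = g' * v" by (metis g'_def gcd_dvd1 dvdE)
  have g0: "g > 0" "g' > 0" using n0 by (auto simp: g_def g'_def)
  obtain A' where A': "A = g * A'" by (metis g_def gcd_dvd2 dvdE)
  have "coprime u A'"
    using n0 u A' g0 by (metis g_def gcd_mult_distrib_nat coprime_iff_gcd_eq_1 mult_cancel1 mult.right_neutral less_not_refl)
  moreover have "u dvd A' * B"
    using dvd u A' g0 by (simp add: mult.assoc)
  ultimately have "u dvd B" by (simp add: coprime_dvd_mult_right_iff)
  moreover have "u dvd n" using u by simp
  ultimately have "u dvd g'" by (simp add: g'_def)
  then have "u \<le> g'" using g0 by (simp add: dvd_imp_le)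
  then have "u * v \<le> n" using v by simp
  then show ?thesis
    using ords u v g0 unfolding g_def[symmetric] g'_def[symmetric] n_def[symmetric]
    by (metis nonzero_mult_div_cancel_left less_not_refl)
qed

text \<open>A primitive root generates the residues prime to \<open>r\<close>. This supplies the
  powers \<open>q ^ s\<close> that carry \<open>\<theta>\<close> to
  \<open>\<theta> [^] j\<close>.\<close>

lemma primitive_root_power_cong:
  fixes q r j :: nat
  assumes r: "Factorial_Ring.prime r" and "coprime r q" "ord r q = r - 1" "coprime j r"
  shows "\<exists>s. [q ^ s = j] (mod r)"
proof -
  have "residue_primroot r q"
    using assms by (simp add: residue_primroot_def totient_prime prime_gt_0_nat)
  then have "bij_betw (\<lambda>i. q ^ i mod r) {..<totient r} (totatives r)"
    using prime_gt_1_nat[OF r] by (intro residue_primroot_is_generator)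
  moreover have "j mod r \<in> totatives r"
  proof -
    have cop: "coprime (j mod r) r"
      using assms(4) prime_gt_0_nat[OF r] by (subst coprime_mod_left_iff) auto
    moreover have "j mod r \<noteq> 0"
    proof
      assume "j mod r = 0"
      then have "coprime 0 r" using cop by (simp only:)
      then show False using prime_gt_1_nat[OF r] by simp
    qed
    moreover have "j mod r \<le> r" using prime_gt_0_nat[OF r] by (simp add: less_imp_le)
    ultimately show ?thesis by (simp add: totatives_def)
  qed
  ultimately have "j mod r \<in> (\<lambda>i. q ^ i mod r) ` {..<totient r}"
    by (simp add: bij_betw_imp_surj_on)
  then obtain s where "j mod r = q ^ s mod r"
    by (rule imageE)
  then show ?thesis by (auto simp: cong_def)
qed

text \<open>The square of this power is congruent to 1, so modulo the prime \<open>r\<close> it is 1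
  or -1; the value 1 would make \<open>r - 1\<close> divide its own half.\<close>

lemma primitive_root_half_power:
  fixes q r :: nat
  assumes r: "Factorial_Ring.prime r" "odd r" and "coprime r q" and ord: "ord r q = r - 1"
  shows "[q ^ ((r - 1) div 2) = r - 1] (mod r)"
proof -
  define b where "b = q ^ ((r - 1) div 2)"
  have r3: "r \<ge> 3" using r prime_ge_2_nat[of r] by (cases "r = 2") auto
  have "(r - 1) div 2 * 2 = r - 1" using r(2) by (auto elim!: oddE)
  then have "b * b = q ^ (r - 1)"
    by (simp add: b_def mult_2_right flip: power_add)
  then have "[b * b = 1] (mod r)"
    using ord ord_divides[of q "r - 1" r] by simp
  \<comment> \<open>Over the integers \<open>b - 1\<close> is not truncated and the difference of
    squares factors.\<close>
  then have "[int b * int b = 1] (mod int r)"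
    by (metis cong_int_iff of_nat_1 of_nat_mult)
  then have "int r dvd (int b - 1) * (int b + 1)"
    by (simp add: cong_iff_dvd_diff algebra_simps)
  then have "int r dvd int b - 1 \<or> int r dvd int b + 1"
    using r(1) by (simp add: prime_dvd_mult_iff)
  moreover have "\<not> int r dvd int b - 1"
  proof
    assume "int r dvd int b - 1"
    then have "[int b = int 1] (mod int r)" by (simp add: cong_iff_dvd_diff)
    then have "[b = 1] (mod r)" by (simp only: cong_int_iff)
    then have "r - 1 dvd (r - 1) div 2"
      using ord ord_divides[of q "(r - 1) div 2" r] by (simp add: b_def)
    then show False using r3 by (auto dest: dvd_imp_le)
  qed
  ultimately have "int r dvd (int b + 1) - int r" by auto
  then have "[int b = int (r - 1)] (mod int r)"
    using r3 by (simp add: cong_iff_dvd_diff of_nat_diff algebra_simps)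
  then show ?thesis by (simp only: cong_int_iff b_def)
qed

text \<open>Otherwise the constant \<open>c\<close> would be a multiple of \<open>\<xi>\<close> and
  therefore zero.\<close>

lemma (in poly_like) linear_nonzero:
  assumes "b \<in> F" "c \<in> F" "c \<noteq> \<zero>" "j \<ge> 1"
  shows "b \<otimes> \<xi> [^] (j :: nat) \<oplus> c \<noteq> \<zero>"
proof
  assume zero: "b \<otimes> \<xi> [^] j \<oplus> c = \<zero>"
  obtain i where j: "j = Suc i" using assms(4) by (cases j) auto
  have cl: "b \<in> carrier R" "c \<in> carrier R" using assms F_carrier by auto
  have "c = \<ominus> (b \<otimes> \<xi> [^] j)"
    using zero cl by (simp add: minus_equality a_comm)
  also have "\<dots> = \<xi> \<otimes> (\<ominus> (b \<otimes> \<xi> [^] i))"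
    using cl by (simp add: j r_minus m_ac)
  finally have "c = \<xi> \<otimes> (\<ominus> (b \<otimes> \<xi> [^] i))" .
  then show False
    using multiple_xi_const[of "\<ominus> (b \<otimes> \<xi> [^] i)"] assms cl by auto
qed

text \<open>The bound \<open>r - 1\<close> is the degree of the polynomial of ones.
  \<open>a_pow_q\<close> makes \<open>a\<close> a fixed point of the \<open>q\<close>-th power map,
  and \<open>theta_pow_r\<close> lets exponents of the image of \<open>X\<close> be read modulo
  \<open>r\<close>.\<close>

locale cyclotomic_extension = faithful_evaluation K L h p "r - 1"
  for K :: "('a, 'b) ring_scheme" and L :: "('c, 'd) ring_scheme" (structure)
    and h :: "'a list \<Rightarrow> 'c" and p r :: nat +
  fixes q k :: nat and a :: 'a
  assumes r_prime: "Factorial_Ring.prime r" and r_odd: "odd r" and q_def: "q = p ^ k"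
    and r_q: "coprime r q" and ord_q: "ord r q = r - 1"
    and a_K: "a \<in> carrier K" "a \<noteq> \<zero>\<^bsub>K\<^esub>" and a_pow_q: "a [^]\<^bsub>K\<^esub> q = a"
    and theta_pow_r: "h X\<^bsub>K\<^esub> [^] r = \<one>"
begin

text \<open>\<open>w e\<close> is \<open>\<theta>\<^sup>e (\<theta> + a)\<close>, while \<open>lin j\<close> and \<open>recip j\<close> are \<open>x\<^sup>j + a\<close> and \<open>a x\<^sup>j + 1 = x\<^sup>j (x\<^sup>-\<^sup>j + a)\<close>.\<close>

definition \<theta> where "\<theta> = h X\<^bsub>K\<^esub>"
definition C where "C = base.poly_of_const a"
definition c where "c = h C"
definition w where "w e = \<theta> [^] (e :: nat) \<otimes> (\<theta> \<oplus> c)"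
definition lin where "lin j = \<one>\<^bsub>poly_ring K\<^esub> \<otimes>\<^bsub>poly_ring K\<^esub> X\<^bsub>K\<^esub> [^]\<^bsub>poly_ring K\<^esub> j \<oplus>\<^bsub>poly_ring K\<^esub> C" for j :: nat
definition recip where "recip j = C \<otimes>\<^bsub>poly_ring K\<^esub> X\<^bsub>K\<^esub> [^]\<^bsub>poly_ring K\<^esub> j \<oplus>\<^bsub>poly_ring K\<^esub> \<one>\<^bsub>poly_ring K\<^esub>" for j :: nat

lemma r_ge_3: "r \<ge> 3"
  using r_prime r_odd prime_ge_2_nat[of r] by (cases "r = 2") auto

lemma r_coprime: "j \<in> {1..r - 1} \<Longrightarrow> coprime j r"
  using r_prime by (metis atLeastAtMost_iff coprime_commute diff_less le_trans less_one linorder_not_less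
      nat_less_le not_one_le_zero prime_gt_0_nat prime_imp_coprime dvd_imp_le)

lemma q_pos: "q > 0"
  using p_prime by (simp add: q_def prime_gt_0_nat)

lemma C_const: "C \<in> base.poly_of_const ` carrier K" "C \<noteq> []" "C \<in> carrier (poly_ring K)"
proof -
  show "C \<in> base.poly_of_const ` carrier K" using a_K by (simp add: C_def)
  then show "C \<in> carrier (poly_ring K)" by (rule UP.F_carrier)
  show "C \<noteq> []" using a_K by (simp add: C_def base.poly_of_const_def)
qed

lemma closed [simp]: "\<theta> \<in> carrier L" "c \<in> carrier L" "w e \<in> carrier L"
  using UP.xi_carrier C_const(3) by (auto simp: \<theta>_def c_def w_def)

lemma poly_closed [simp]: "lin j \<in> carrier (poly_ring K)" "recip j \<in> carrier (poly_ring K)"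
  using UP.xi_carrier C_const(3) by (auto simp: lin_def recip_def)

lemma h_lin [simp]: "h (lin j) = \<theta> [^] j \<oplus> c" and h_recip [simp]: "h (recip j) = c \<otimes> \<theta> [^] j \<oplus> \<one>"
  using UP.xi_carrier C_const(3) by (simp_all add: lin_def recip_def \<theta>_def c_def)

lemma theta_nonzero: "\<theta> \<noteq> \<zero>"
  using theta_pow_r r_ge_3 by (auto simp: \<theta>_def nat_pow_zero)

lemma theta_pow_cong: "[i = j] (mod r) \<Longrightarrow> \<theta> [^] i = \<theta> [^] j"
proof -
  have *: "\<theta> [^] i = \<theta> [^] (i mod r)" for i
  proof -
    have "\<theta> [^] i = \<theta> [^] (r * (i div r) + i mod r)" by simp
    also have "\<dots> = (\<theta> [^] r) [^] (i div r) \<otimes> \<theta> [^] (i mod r)"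
      by (simp only: nat_pow_mult[symmetric] nat_pow_pow closed nat_pow_closed)
    finally show ?thesis using theta_pow_r by (simp add: \<theta>_def)
  qed
  show "[i = j] (mod r) \<Longrightarrow> \<theta> [^] i = \<theta> [^] j"
    using *[of i] *[of j] by (simp add: cong_def)
qed

lemma c_pow: "c [^] (q ^ s) = c"
proof -
  interpret const: ring_hom_ring K "poly_ring K" base.poly_of_const
    using base.canonical_embedding_ring_hom[OF base.carrier_is_subring] by simp
  have "C [^]\<^bsub>poly_ring K\<^esub> q = C"
    using const.hom_nat_pow[of a q] a_K a_pow_q by (simp add: C_def)
  then have "c [^] q = c"
    using C_const unfolding c_def by (metis h.hom_pow)
  then show ?thesis
    by (induction s) (simp_all add: nat_pow_pow[symmetric])
qed

lemma char_L: "add_pow L p \<one> = \<zero>"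
  using base.char_hom[OF domain_axioms h_hom char_K] .

lemma frobenius_q: "x \<in> carrier L \<Longrightarrow> y \<in> carrier L \<Longrightarrow> (x \<oplus> y) [^] (q ^ s) = x [^] (q ^ s) \<oplus> y [^] (q ^ s)"
  unfolding q_def power_mult[symmetric] by (rule frobenius_power_add[OF p_prime char_L])

text \<open>Raising to the power \<open>q ^ s\<close> is additive and fixes \<open>c\<close>, so it
  acts only on the exponent of \<open>\<theta>\<close>.\<close>

lemma conj_lin: "(\<theta> [^] i \<oplus> c) [^] (q ^ s) = \<theta> [^] (i * q ^ s) \<oplus> c"
  by (simp add: frobenius_q nat_pow_pow c_pow)

lemma conj_recip: "(c \<otimes> \<theta> [^] i \<oplus> \<one>) [^] (q ^ s) = c \<otimes> \<theta> [^] (i * q ^ s) \<oplus> \<one>"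
  by (simp add: frobenius_q nat_pow_pow nat_pow_distrib c_pow)

lemma conj_w: "w e [^] (q ^ s) = \<theta> [^] (e * q ^ s) \<otimes> (\<theta> [^] (q ^ s) \<oplus> c)"
  using conj_lin[of 1 s] by (simp add: w_def nat_pow_distrib nat_pow_pow)

text \<open>A discrete logarithm of \<open>j\<close> to the base \<open>q\<close> modulo
  \<open>r\<close>. Any choice serves, since powers of \<open>\<theta>\<close> depend only on
  exponents modulo \<open>r\<close>.\<close>

definition \<sigma> where "\<sigma> j = (SOME s. [q ^ s = j] (mod r))"

lemma \<sigma>: "j \<in> {1..r - 1} \<Longrightarrow> [q ^ \<sigma> j = j] (mod r)"
  unfolding \<sigma>_def using primitive_root_power_cong[OF r_prime r_q ord_q r_coprime] by (rule someI_ex)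

lemma theta_pow_\<sigma>: "j \<in> {1..r - 1} \<Longrightarrow> \<theta> [^] (i * q ^ \<sigma> j) = \<theta> [^] (i * j)"
  using \<sigma> by (intro theta_pow_cong cong_mult) auto

lemma lin_degree: "degree (lin j) \<le> j" and recip_degree: "degree (recip j) \<le> j"
  unfolding lin_def recip_def
  using base.degree_linear_le C_const(1) UP.F_closed(2) by blast+

text \<open>\<open>\<theta> \<oplus> c\<close> is the value of a non-zero polynomial of degree at
  most 1, which is below \<open>r - 1\<close>.\<close>

lemma w_nonzero: "w e \<noteq> \<zero>"
proof -
  have "h (lin 1) \<noteq> \<zero>"
  proof
    assume "h (lin 1) = \<zero>"
    then have "h (lin 1) = h \<zero>\<^bsub>poly_ring K\<^esub>" by simp
    then have "lin 1 = \<zero>\<^bsub>poly_ring K\<^esub>"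
      using lin_degree[of 1] r_ge_3 by (intro h_inj) (auto simp: univ_poly_zero)
    then show False
      using UP.linear_nonzero[OF UP.F_closed(2) C_const(1), of 1] C_const(2)
      by (simp add: lin_def univ_poly_zero)
  qed
  then show ?thesis
    by (simp add: w_def integral_iff nat_pow_nonzero theta_nonzero)
qed

end

section \<open>Jets of the conjugates and the two counts\<close>

context cyclotomic_extension
begin

lemma C_F: "C \<in> base.poly_of_const ` carrier K" "C \<noteq> \<zero>\<^bsub>poly_ring K\<^esub>"
  using C_const by (simp_all add: univ_poly_zero)

text \<open>The coefficients \<open>1/a\<close> here and \<open>a\<close> for \<open>recip j\<close>
  coincide only if the square of \<open>a\<close> is 1; the second bound rests on this
  contrast.\<close>

lemma jet_lin: "poly_log_jet K j (lin j) (inv\<^bsub>poly_ring K\<^esub> C)"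
  using UP.log_jet_linear[OF UP.F_closed(2) C_F, of j] UP.F_carrier[OF UP.F_inverse(1)[OF C_F]]
  by (simp add: lin_def)

lemma jet_recip: "poly_log_jet K j (recip j) C"
proof -
  have "inv\<^bsub>poly_ring K\<^esub> \<one>\<^bsub>poly_ring K\<^esub> = \<one>\<^bsub>poly_ring K\<^esub>" by (rule UP.inv_one)
  then show ?thesis
    using UP.log_jet_linear[OF C_F(1) UP.F_closed(2), of j] C_const(3) by (simp add: recip_def)
qed

lemma jets_below:
  assumes "i < j"
  shows "poly_log_jet K i (lin j) \<zero>\<^bsub>poly_ring K\<^esub>" "poly_log_jet K i (recip j) \<zero>\<^bsub>poly_ring K\<^esub>"
  unfolding lin_def recip_def
  using UP.log_jet_linear_below[OF UP.F_closed(2) C_F assms]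
    UP.log_jet_linear_below[OF C_F(1) UP.F_closed(2) UP.one_not_zero assms] by simp_all

lemma lin_nonzero: "j \<ge> 1 \<Longrightarrow> lin j \<noteq> \<zero>\<^bsub>poly_ring K\<^esub>"
  and recip_nonzero: "j \<ge> 1 \<Longrightarrow> recip j \<noteq> \<zero>\<^bsub>poly_ring K\<^esub>"
  unfolding lin_def recip_def
  using UP.linear_nonzero[OF UP.F_closed(2) C_F] UP.linear_nonzero[OF C_F(1) UP.F_closed(2) UP.one_not_zero]
  by simp_all

lemma inv_C: "inv\<^bsub>poly_ring K\<^esub> C \<in> carrier (poly_ring K)" "inv\<^bsub>poly_ring K\<^esub> C \<noteq> \<zero>\<^bsub>poly_ring K\<^esub>"
  "C \<otimes>\<^bsub>poly_ring K\<^esub> inv\<^bsub>poly_ring K\<^esub> C = \<one>\<^bsub>poly_ring K\<^esub>"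
  using UP.F_carrier[OF UP.F_inverse(1)[OF C_F]] UP.F_inverse(2)[OF C_F] C_const(3) by auto

text \<open>No denominators occur: the power \<open>q ^ \<sigma> j\<close> turns \<open>w e\<close>
  into \<open>\<theta> [^] (e * j) \<otimes> (\<theta> [^] j \<oplus> c)\<close>, so
  \<open>\<tau>\<close> is \<open>\<theta> [^] e\<close>. Partitions of \<open>r - 2\<close> use
  degrees up to \<open>r - 2\<close>, just below the limit.\<close>

lemma U_part_le_ord_w: "U_part (r - 2) (p - 1) \<le> G.ord (w e)"
proof (rule U_part_le_ord[where A = "\<lambda>_. \<one>\<^bsub>poly_ring K\<^esub>" and B = lin and m = "\<lambda>j. j" and s = 1 and t = 0
      and e = "\<lambda>j. q ^ \<sigma> j" and \<tau> = "\<theta> [^] e"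
      and dA = "\<lambda>_. \<zero>\<^bsub>poly_ring K\<^esub>" and dB = "\<lambda>_. inv\<^bsub>poly_ring K\<^esub> C"])
  fix j assume j: "j \<in> {1..r - 2}"
  then have j': "j \<in> {1..r - 1}" by auto
  show "\<one>\<^bsub>poly_ring K\<^esub> \<in> carrier (poly_ring K) - {[]} \<and> lin j \<in> carrier (poly_ring K) - {[]}"
    using lin_nonzero j UP.one_not_zero by (auto simp: univ_poly_zero)
  show "poly_log_jet K j \<one>\<^bsub>poly_ring K\<^esub> \<zero>\<^bsub>poly_ring K\<^esub> \<and> poly_log_jet K j (lin j) (inv\<^bsub>poly_ring K\<^esub> C)
      \<and> \<zero>\<^bsub>poly_ring K\<^esub> \<noteq> inv\<^bsub>poly_ring K\<^esub> C"
    using UP.log_jet_one jet_lin inv_C(2) by metis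
  show "degree (lin j) \<le> 1 * j \<and> degree (\<one>\<^bsub>poly_ring K\<^esub>) \<le> 0 * j"
    using lin_degree[of j] by (simp add: univ_poly_one)
  have "w e [^] q ^ \<sigma> j = \<theta> [^] (e * j) \<otimes> (\<theta> [^] j \<oplus> c)"
    using theta_pow_\<sigma>[OF j', of e] theta_pow_\<sigma>[OF j', of 1] by (simp add: conj_w)
  then show "w e [^] q ^ \<sigma> j \<otimes> h \<one>\<^bsub>poly_ring K\<^esub> = (\<theta> [^] e) [^] j \<otimes> h (lin j)"
    by (simp add: nat_pow_pow)
next
  fix i j :: nat assume "i < j"
  then show "poly_log_jet K i \<one>\<^bsub>poly_ring K\<^esub> [] \<and> poly_log_jet K i (lin j) []"
    using UP.log_jet_one[of i] jets_below(1) by (simp add: univ_poly_zero)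
qed (use r_ge_3 w_nonzero theta_nonzero in \<open>auto simp: nat_pow_nonzero\<close>)

definition Q where "Q = q ^ ((r - 1) div 2)"
text \<open>The inverse of \<open>\<theta>\<close>, and also its \<open>Q\<close>-th power, written
  with a natural exponent.\<close>

definition \<theta>' where "\<theta>' = \<theta> [^] (r - 1)"

lemma theta'_closed [simp]: "\<theta>' \<in> carrier L"
  by (simp add: \<theta>'_def)

lemma theta'_nonzero: "\<theta>' \<noteq> \<zero>"
  by (simp add: \<theta>'_def nat_pow_nonzero theta_nonzero)

lemma theta'_theta: "\<theta>' \<otimes> \<theta> = \<one>"
proof -
  have "\<theta>' \<otimes> \<theta> = \<theta> [^] Suc (r - 1)" by (simp add: \<theta>'_def)
  then show ?thesis using theta_pow_r r_ge_3 by (simp add: \<theta>_def del: nat_pow_Suc)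
qed

lemma theta'_theta_pow: "\<theta>' [^] e \<otimes> \<theta> [^] (e :: nat) = \<one>"
  using theta'_theta by (simp add: nat_pow_distrib[symmetric])

lemma Q_cong: "[Q = r - 1] (mod r)"
  unfolding Q_def by (rule primitive_root_half_power[OF r_prime r_odd r_q ord_q])

text \<open>As \<open>Q\<close> is -1 modulo \<open>r\<close>, the \<open>Q\<close>-th power
  replaces \<open>\<theta>\<close> by \<open>\<theta>'\<close>; then \<open>\<theta>'\<close> is
  factored out of \<open>\<theta>' \<oplus> c\<close>.\<close>

lemma w_pow_Q: "w e [^] Q = \<theta>' [^] e \<otimes> (\<theta>' \<otimes> (c \<otimes> \<theta> \<oplus> \<one>))"
proof -
  have "\<theta> [^] (e * Q) = \<theta>' [^] e"
    using theta_pow_cong[OF cong_mult[OF cong_refl Q_cong], of e]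
    by (simp add: \<theta>'_def nat_pow_pow mult.commute)
  moreover have "\<theta> [^] Q = \<theta>'"
    using theta_pow_cong[OF Q_cong] by (simp add: \<theta>'_def)
  moreover have "\<theta>' \<oplus> c = \<theta>' \<otimes> (c \<otimes> \<theta> \<oplus> \<one>)"
  proof -
    have "\<theta>' \<otimes> (c \<otimes> \<theta> \<oplus> \<one>) = c \<otimes> (\<theta>' \<otimes> \<theta>) \<oplus> \<theta>'"
      by (simp add: r_distr m_lcomm)
    then show ?thesis by (simp add: theta'_theta a_comm)
  qed
  ultimately show ?thesis
    using conj_w[of e "(r - 1) div 2"] by (simp add: Q_def)
qed

lemma theta'_pow_\<sigma>: "j \<in> {1..r - 1} \<Longrightarrow> \<theta>' [^] (q ^ \<sigma> j) = \<theta>' [^] j"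
  using theta_pow_\<sigma>[of j "r - 1"] by (simp add: \<theta>'_def nat_pow_pow)

lemma conj_lin_recip:
  assumes "j \<in> {1..r - 1}"
  shows "(\<theta> \<oplus> c) [^] (q ^ \<sigma> j) = h (lin j)" "(c \<otimes> \<theta> \<oplus> \<one>) [^] (q ^ \<sigma> j) = h (recip j)"
  using conj_lin[of 1 "\<sigma> j"] conj_recip[of 1 "\<sigma> j"] theta_pow_\<sigma>[OF assms, of 1] by simp_all

text \<open>The factors \<open>\<theta>' [^] e\<close> and \<open>\<theta> [^] e\<close> cancel, so
  the result does not depend on \<open>e\<close>.\<close>

lemma w_pow_Suc_Q: "w e [^] (Q + 1) = \<theta>' \<otimes> ((\<theta> \<oplus> c) \<otimes> (c \<otimes> \<theta> \<oplus> \<one>))"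
proof -
  have "w e [^] (Q + 1) = (\<theta>' [^] e \<otimes> \<theta> [^] e) \<otimes> (\<theta>' \<otimes> ((\<theta> \<oplus> c) \<otimes> (c \<otimes> \<theta> \<oplus> \<one>)))"
    by (simp add: w_pow_Q) (simp add: w_def m_ac)
  then show ?thesis by (simp add: theta'_theta_pow)
qed

lemma Q_gt_1: "Q > 1"
proof -
  have "q \<noteq> 1" using ord_q r_ge_3 by auto
  then show ?thesis using q_pos r_ge_3 unfolding Q_def by (intro one_less_power) auto
qed

text \<open>This is \<open>w_pow_Q\<close> divided by \<open>w e\<close>, with
  \<open>\<theta> \<oplus> c\<close> kept on the left. The exponent \<open>2 * e + 1\<close>
  collects \<open>e\<close> from the \<open>Q\<close>-th power, \<open>e\<close> from dividing by
  \<open>\<theta> [^] e\<close>, and 1 from factoring out \<open>\<theta>'\<close>.\<close>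

lemma w_pow_pred_Q: "w e [^] (Q - 1) \<otimes> (\<theta> \<oplus> c) = \<theta>' [^] (2 * e + 1) \<otimes> (c \<otimes> \<theta> \<oplus> \<one>)"
proof -
  have "w e [^] Suc (Q - 1) = w e [^] (Q - 1) \<otimes> w e" by simp
  then have "w e [^] (Q - 1) \<otimes> w e = \<theta>' [^] e \<otimes> (\<theta>' \<otimes> (c \<otimes> \<theta> \<oplus> \<one>))"
    using Q_gt_1 by (simp add: w_pow_Q del: nat_pow_Suc)
  then have "\<theta>' [^] e \<otimes> (w e [^] (Q - 1) \<otimes> (\<theta> [^] e \<otimes> (\<theta> \<oplus> c)))
      = \<theta>' [^] e \<otimes> (\<theta>' [^] e \<otimes> (\<theta>' \<otimes> (c \<otimes> \<theta> \<oplus> \<one>)))"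
    by (simp add: w_def)
  moreover have "\<theta>' [^] e \<otimes> (w e [^] (Q - 1) \<otimes> (\<theta> [^] e \<otimes> (\<theta> \<oplus> c)))
      = (\<theta>' [^] e \<otimes> \<theta> [^] e) \<otimes> (w e [^] (Q - 1) \<otimes> (\<theta> \<oplus> c))"
    by (simp add: m_ac)
  moreover have "\<theta>' [^] e \<otimes> (\<theta>' [^] e \<otimes> (\<theta>' \<otimes> (c \<otimes> \<theta> \<oplus> \<one>))) = \<theta>' [^] (2 * e + 1) \<otimes> (c \<otimes> \<theta> \<oplus> \<one>)"
    by (simp add: mult_2 nat_pow_mult[symmetric] m_assoc)
  ultimately show ?thesis by (simp add: theta'_theta_pow)
qed

lemma half_index: "j \<in> {1..(r - 3) div 2} \<Longrightarrow> j \<in> {1..r - 1}"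
  by auto

text \<open>For the exponents \<open>Q - 1\<close> and \<open>Q + 1\<close> a partition of
  \<open>(r - 3) div 2\<close> may cost twice its size in degree.\<close>

lemma half_bound: "2 * ((r - 3) div 2) < r - 1"
  using r_ge_3 by linarith

text \<open>The numerators \<open>recip j\<close> and denominators \<open>lin j\<close> are told
  apart by their coefficients \<open>C\<close> and its inverse, which differ by the
  assumption.\<close>

lemma U_part_le_ord_pred_Q:
  assumes "C \<otimes>\<^bsub>poly_ring K\<^esub> C \<noteq> \<one>\<^bsub>poly_ring K\<^esub>"
  shows "U_part ((r - 3) div 2) (p - 1) \<le> G.ord (w e [^] (Q - 1))"
proof (rule U_part_le_ord[where A = lin and B = recip and m = "\<lambda>j. j" and s = 1 and t = 1
      and e = "\<lambda>j. q ^ \<sigma> j" and \<tau> = "\<theta>' [^] (2 * e + 1)"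
      and dA = "\<lambda>_. inv\<^bsub>poly_ring K\<^esub> C" and dB = "\<lambda>_. C"])
  fix j assume j: "j \<in> {1..(r - 3) div 2}"
  note j' = half_index[OF j]
  show "lin j \<in> carrier (poly_ring K) - {[]} \<and> recip j \<in> carrier (poly_ring K) - {[]}"
    using lin_nonzero recip_nonzero j by (auto simp: univ_poly_zero)
  have "inv\<^bsub>poly_ring K\<^esub> C \<noteq> C" using inv_C(3) assms by metis
  then show "poly_log_jet K j (lin j) (inv\<^bsub>poly_ring K\<^esub> C) \<and> poly_log_jet K j (recip j) C \<and> inv\<^bsub>poly_ring K\<^esub> C \<noteq> C"
    using jet_lin jet_recip by blast
  show "degree (recip j) \<le> 1 * j \<and> degree (lin j) \<le> 1 * j"
    using lin_degree[of j] recip_degree[of j] by simp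
  have "(w e [^] (Q - 1)) [^] q ^ \<sigma> j \<otimes> h (lin j) = (w e [^] (Q - 1) \<otimes> (\<theta> \<oplus> c)) [^] q ^ \<sigma> j"
    using conj_lin_recip[OF j'] by (simp add: nat_pow_distrib)
  also have "\<dots> = (\<theta>' [^] (2 * e + 1)) [^] q ^ \<sigma> j \<otimes> h (recip j)"
    unfolding w_pow_pred_Q using conj_lin_recip[OF j'] by (simp add: nat_pow_distrib del: nat_pow_Suc)
  also have "(\<theta>' [^] (2 * e + 1)) [^] q ^ \<sigma> j = (\<theta>' [^] q ^ \<sigma> j) [^] (2 * e + 1)"
    by (simp only: nat_pow_pow theta'_closed mult.commute)
  also have "\<dots> = (\<theta>' [^] (2 * e + 1)) [^] j"
    unfolding theta'_pow_\<sigma>[OF j'] by (simp only: nat_pow_pow theta'_closed mult.commute)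
  finally show "(w e [^] (Q - 1)) [^] q ^ \<sigma> j \<otimes> h (lin j) = (\<theta>' [^] (2 * e + 1)) [^] j \<otimes> h (recip j)" .
next
  fix i j :: nat assume "i < j"
  then show "poly_log_jet K i (lin j) [] \<and> poly_log_jet K i (recip j) []"
    using jets_below by (simp add: univ_poly_zero)
qed (use half_bound w_nonzero theta'_nonzero in \<open>auto simp: nat_pow_nonzero integral_iff\<close>)

text \<open>The polynomials \<open>B j\<close> and jet orders \<open>m j\<close> stay open because
  the first coefficient of \<open>lin j\<close> times \<open>recip j\<close> can vanish, and then
  another order is required.\<close>

lemma U_part_le_ord_Suc_QI:
  assumes B: "\<And>j. j \<in> {1..(r - 3) div 2} \<Longrightarrow> B j \<in> carrier (poly_ring K) - {[]} \<and> h (B j) = h (lin j) \<otimes> h (recip j)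
      \<and> degree (B j) \<le> 2 * j \<and> m j \<ge> 1 \<and> poly_log_jet K (m j) (B j) d"
    and d: "d \<noteq> \<zero>\<^bsub>poly_ring K\<^esub>"
    and above: "\<And>i j. 1 \<le> i \<Longrightarrow> i < j \<Longrightarrow> poly_log_jet K (m i) (B j) \<zero>\<^bsub>poly_ring K\<^esub>"
  shows "U_part ((r - 3) div 2) (p - 1) \<le> G.ord (w e [^] (Q + 1))"
proof (rule U_part_le_ord[where A = "\<lambda>_. \<one>\<^bsub>poly_ring K\<^esub>" and B = B and m = m and s = 2 and t = 0
      and e = "\<lambda>j. q ^ \<sigma> j" and \<tau> = \<theta>'
      and dA = "\<lambda>_. \<zero>\<^bsub>poly_ring K\<^esub>" and dB = "\<lambda>_. d"])
  fix j assume j: "j \<in> {1..(r - 3) div 2}"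
  note j' = half_index[OF j]
  show "\<one>\<^bsub>poly_ring K\<^esub> \<in> carrier (poly_ring K) - {[]} \<and> B j \<in> carrier (poly_ring K) - {[]}"
    using B[OF j] UP.one_not_zero by (simp add: univ_poly_zero)
  show "m j \<ge> 1" using B[OF j] by blast
  show "poly_log_jet K (m j) \<one>\<^bsub>poly_ring K\<^esub> \<zero>\<^bsub>poly_ring K\<^esub> \<and> poly_log_jet K (m j) (B j) d \<and> \<zero>\<^bsub>poly_ring K\<^esub> \<noteq> d"
    using UP.log_jet_one B[OF j] d by metis
  show "degree (B j) \<le> 2 * j \<and> degree (\<one>\<^bsub>poly_ring K\<^esub>) \<le> 0 * j"
    using B[OF j] by (simp add: univ_poly_one)
  have "(w e [^] (Q + 1)) [^] q ^ \<sigma> j = \<theta>' [^] j \<otimes> (h (lin j) \<otimes> h (recip j))"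
    unfolding w_pow_Suc_Q using conj_lin_recip[OF j'] theta'_pow_\<sigma>[OF j']
    by (simp add: nat_pow_distrib)
  then show "(w e [^] (Q + 1)) [^] q ^ \<sigma> j \<otimes> h \<one>\<^bsub>poly_ring K\<^esub> = \<theta>' [^] j \<otimes> h (B j)"
    using B[OF j] by simp
next
  fix i j assume "i \<in> {1..(r - 3) div 2}" "i < j"
  then show "poly_log_jet K (m i) \<one>\<^bsub>poly_ring K\<^esub> [] \<and> poly_log_jet K (m i) (B j) []"
    using UP.log_jet_one[of "m i"] above[of i j] by (simp add: univ_poly_zero)
qed (use half_bound w_nonzero theta'_nonzero in \<open>auto simp: nat_pow_nonzero integral_iff\<close>)

end

context cyclotomic_extension
begin

text \<open>At order \<open>j\<close> the product of \<open>lin j\<close> and \<open>recip j\<close>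
  has coefficient \<open>1/a + a\<close>. If this is zero, the jets are taken at order
  \<open>2 * j\<close>, where the coefficient is 1.\<close>

lemma U_part_le_ord_Suc_Q: "U_part ((r - 3) div 2) (p - 1) \<le> G.ord (w e [^] (Q + 1))"
proof (cases "inv\<^bsub>poly_ring K\<^esub> C \<oplus>\<^bsub>poly_ring K\<^esub> C = \<zero>\<^bsub>poly_ring K\<^esub>")
  case False
  show ?thesis
  proof (rule U_part_le_ord_Suc_QI[where B = "\<lambda>j. lin j \<otimes>\<^bsub>poly_ring K\<^esub> recip j" and m = "\<lambda>j. j"
        and d = "inv\<^bsub>poly_ring K\<^esub> C \<oplus>\<^bsub>poly_ring K\<^esub> C", OF _ False])
    fix j assume "j \<in> {1..(r - 3) div 2}"
    then have j: "j \<ge> 1" by simp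
    have "lin j \<otimes>\<^bsub>poly_ring K\<^esub> recip j \<noteq> []"
      using UP.integral[of "lin j" "recip j"] lin_nonzero[OF j] recip_nonzero[OF j]
      by (auto simp: univ_poly_zero)
    moreover have "degree (lin j \<otimes>\<^bsub>poly_ring K\<^esub> recip j) \<le> 2 * j"
      using base.degree_mult_le[of "lin j" "recip j"] lin_degree[of j] recip_degree[of j] by simp
    ultimately show "lin j \<otimes>\<^bsub>poly_ring K\<^esub> recip j \<in> carrier (poly_ring K) - {[]}
        \<and> h (lin j \<otimes>\<^bsub>poly_ring K\<^esub> recip j) = h (lin j) \<otimes> h (recip j)
        \<and> degree (lin j \<otimes>\<^bsub>poly_ring K\<^esub> recip j) \<le> 2 * j \<and> j \<ge> 1
        \<and> poly_log_jet K j (lin j \<otimes>\<^bsub>poly_ring K\<^esub> recip j) (inv\<^bsub>poly_ring K\<^esub> C \<oplus>\<^bsub>poly_ring K\<^esub> C)"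
      using UP.log_jet_mult[OF j jet_lin jet_recip] j by simp
  next
    fix i j :: nat assume "1 \<le> i" "i < j"
    then show "poly_log_jet K i (lin j \<otimes>\<^bsub>poly_ring K\<^esub> recip j) \<zero>\<^bsub>poly_ring K\<^esub>"
      using UP.log_jet_mult[OF _ jets_below] by fastforce
  qed
next
  case True
  \<comment> \<open>Here \<open>a\<^sup>2 = -1\<close>, and the factor \<open>(x\<^sup>j + a) (a x\<^sup>j + 1)\<close> collapses to \<open>a x\<^sup>2\<^sup>j + a\<close>.\<close>
  define D where "D j = C \<otimes>\<^bsub>poly_ring K\<^esub> X\<^bsub>K\<^esub> [^]\<^bsub>poly_ring K\<^esub> j \<oplus>\<^bsub>poly_ring K\<^esub> C" for j :: nat
  have "C \<otimes>\<^bsub>poly_ring K\<^esub> (inv\<^bsub>poly_ring K\<^esub> C \<oplus>\<^bsub>poly_ring K\<^esub> C) = \<zero>\<^bsub>poly_ring K\<^esub>"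
    unfolding True using C_const(3) by simp
  then have "\<one>\<^bsub>poly_ring K\<^esub> \<oplus>\<^bsub>poly_ring K\<^esub> C \<otimes>\<^bsub>poly_ring K\<^esub> C = \<zero>\<^bsub>poly_ring K\<^esub>"
    using inv_C C_const(3) by (simp add: UP.r_distr)
  then have "h (\<one>\<^bsub>poly_ring K\<^esub> \<oplus>\<^bsub>poly_ring K\<^esub> C \<otimes>\<^bsub>poly_ring K\<^esub> C) = \<zero>" by simp
  then have cc: "\<one> \<oplus> c \<otimes> c = \<zero>" using C_const(3) by (simp add: c_def)
  have jet: "poly_log_jet K j (D j) \<one>\<^bsub>poly_ring K\<^esub>" for j
    using UP.log_jet_linear[OF C_F(1) C_F, of j] inv_C(3) by (simp add: D_def)
  have D_cl: "D j \<in> carrier (poly_ring K)" for j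
    using C_const(3) UP.xi_carrier by (simp add: D_def)
  show ?thesis
  proof (rule U_part_le_ord_Suc_QI[where B = "\<lambda>j. D (2 * j)" and m = "\<lambda>j. 2 * j", OF _ UP.one_not_zero])
    fix j assume "j \<in> {1..(r - 3) div 2}"
    then have j: "2 * j \<ge> 1" by simp
    have "D (2 * j) \<noteq> []"
      using UP.linear_nonzero[OF C_F(1) C_F j] by (simp add: D_def univ_poly_zero)
    moreover have "h (D (2 * j)) = h (lin j) \<otimes> h (recip j)"
    proof -
      define x where "x = \<theta> [^] j"
      have x: "x \<in> carrier L" by (simp add: x_def)
      \<comment> \<open>The mixed terms combine to the coefficient
        \<open>\<one> \<oplus> c \<otimes> c\<close>, which is zero by \<open>cc\<close>.\<close>
      have "h (lin j) \<otimes> h (recip j) = (c \<otimes> (x \<otimes> x) \<oplus> c) \<oplus> (\<one> \<oplus> c \<otimes> c) \<otimes> x"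
        using x by (simp add: x_def[symmetric] l_distr r_distr m_ac a_ac)
      also have "\<dots> = c \<otimes> (x \<otimes> x) \<oplus> c" unfolding cc using x by simp
      also have "x \<otimes> x = \<theta> [^] (2 * j)"
        by (simp add: x_def nat_pow_mult mult_2)
      also have "c \<otimes> \<theta> [^] (2 * j) \<oplus> c = h (D (2 * j))"
        using C_const(3) UP.xi_carrier by (simp add: D_def c_def \<theta>_def)
      finally show ?thesis by simp
    qed
    moreover have "degree (D (2 * j)) \<le> 2 * j"
      unfolding D_def by (rule base.degree_linear_le[OF C_F(1) C_F(1)])
    ultimately show "D (2 * j) \<in> carrier (poly_ring K) - {[]} \<and> h (D (2 * j)) = h (lin j) \<otimes> h (recip j)
        \<and> degree (D (2 * j)) \<le> 2 * j \<and> 2 * j \<ge> 1 \<and> poly_log_jet K (2 * j) (D (2 * j)) \<one>\<^bsub>poly_ring K\<^esub>"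
      using jet D_cl j by blast
  next
    fix i j :: nat assume "1 \<le> i" "i < j"
    then have "2 * i < 2 * j" by simp
    from UP.log_jet_linear_below[OF C_F(1) C_F this]
    show "poly_log_jet K (2 * i) (D (2 * j)) \<zero>\<^bsub>poly_ring K\<^esub>"
      unfolding D_def .
  qed
qed

lemma C_square:
  assumes "C \<otimes>\<^bsub>poly_ring K\<^esub> C = \<one>\<^bsub>poly_ring K\<^esub>"
  shows "a = \<one>\<^bsub>K\<^esub> \<or> a = \<ominus>\<^bsub>K\<^esub> \<one>\<^bsub>K\<^esub>"
proof -
  interpret const: ring_hom_ring K "poly_ring K" base.poly_of_const
    using base.canonical_embedding_ring_hom[OF base.carrier_is_subring] by simp
  have "base.poly_of_const (a \<otimes>\<^bsub>K\<^esub> a) = [\<one>\<^bsub>K\<^esub>]"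
    using assms a_K by (simp add: C_def univ_poly_one)
  then have "a \<otimes>\<^bsub>K\<^esub> a = \<one>\<^bsub>K\<^esub>"
    by (simp add: base.poly_of_const_def split: if_splits)
  then show ?thesis
    using base.square_eq_one a_K(1) by blast
qed

text \<open>Since \<open>q ^ (r - 1)\<close> is 1 modulo \<open>r\<close>, that power fixes
  \<open>w e\<close>. So the order of \<open>w e\<close> divides
  \<open>q ^ (r - 1) - 1 = (Q - 1) * (Q + 1)\<close>, and the bounds for the two powers
  multiply.\<close>

lemma w_order:
  assumes "a \<noteq> \<one>\<^bsub>K\<^esub>" "a \<noteq> \<ominus>\<^bsub>K\<^esub> \<one>\<^bsub>K\<^esub>"
  shows "(U_part ((r - 3) div 2) (p - 1))\<^sup>2 \<le> G.ord (w e)"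
proof -
  have "[1 = q ^ (r - 1)] (mod r)"
    using ord_divides[of q "r - 1" r] ord_q by (simp add: cong_sym_eq)
  then have cong: "\<theta> [^] (i * q ^ (r - 1)) = \<theta> [^] i" for i
    using theta_pow_cong[OF cong_mult[OF cong_refl, of 1 "q ^ (r - 1)" r i]] by simp
  have "w e [^] (q ^ (r - 1)) = w e"
    unfolding conj_w using cong[of e] cong[of 1] by (simp add: w_def)
  moreover have "q ^ (r - 1) = Suc ((Q - 1) * (Q + 1))"
  proof -
    have "q ^ (r - 1) = Q * Q"
      using r_odd by (auto elim!: oddE simp: Q_def power_add[symmetric] mult_2)
    moreover have "Q * Q = Suc ((Q - 1) * (Q + 1))"
      using Q_gt_1 by (cases Q) auto
    ultimately show ?thesis by simp
  qed
  ultimately have "w e [^] ((Q - 1) * (Q + 1)) \<otimes> w e = \<one> \<otimes> w e" by simp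
  then have "w e [^] ((Q - 1) * (Q + 1)) = \<one>"
    using w_nonzero m_rcancel[of "w e" "w e [^] ((Q - 1) * (Q + 1))" \<one>] by simp
  then have "G.ord (w e [^] (Q - 1)) * G.ord (w e [^] (Q + 1)) \<le> G.ord (w e)"
    using G.ord_pow_mult_ord_pow_le[of "w e" "Q - 1" "Q + 1"] w_nonzero Q_gt_1
    by (simp add: Multiplicative_Group.nat_pow_mult_of del: nat_pow_Suc)
  moreover have "C \<otimes>\<^bsub>poly_ring K\<^esub> C \<noteq> \<one>\<^bsub>poly_ring K\<^esub>"
    using C_square assms by blast
  ultimately show ?thesis
    using mult_le_mono[OF U_part_le_ord_pred_Q U_part_le_ord_Suc_Q, of e e]
    unfolding power2_eq_square by linarith
qed

text \<open>If \<open>q ^ t\<close> inverts \<open>F\<close> modulo \<open>r\<close>, then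
  \<open>z [^] (q ^ t)\<close> is some \<open>w e\<close>, and the order of a power does not exceed
  that of \<open>z\<close>.\<close>

lemma ord_bounds:
  fixes E F :: nat
  assumes "coprime F r"
  defines "z \<equiv> \<theta> [^] E \<otimes> (\<theta> [^] F \<oplus> c)"
  shows "U_part (r - 2) (p - 1) \<le> G.ord z"
    and "a \<noteq> \<one>\<^bsub>K\<^esub> \<Longrightarrow> a \<noteq> \<ominus>\<^bsub>K\<^esub> \<one>\<^bsub>K\<^esub> \<Longrightarrow> (U_part ((r - 3) div 2) (p - 1))\<^sup>2 \<le> G.ord z"
proof -
  obtain F' where F': "[F * F' = 1] (mod r)"
    using cong_solve_coprime_nat[OF assms(1)] by auto
  then have "coprime F' r"
    by (metis cong_imp_coprime cong_sym coprime_1_left coprime_mult_left_iff)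
  then obtain t where t: "[q ^ t = F'] (mod r)"
    using primitive_root_power_cong[OF r_prime r_q ord_q] by blast
  have "[F * q ^ t = 1] (mod r)"
    using cong_trans[OF cong_mult[OF cong_refl t] F'] .
  then have "\<theta> [^] (F * q ^ t) = \<theta>"
    using theta_pow_cong[of "F * q ^ t" 1] by simp
  then have zw: "z [^] (q ^ t) = w (E * q ^ t)"
    by (simp add: z_def nat_pow_distrib nat_pow_pow conj_lin w_def)
  have z_cl: "z \<in> carrier L" by (simp add: z_def)
  \<comment> \<open>A power of \<open>z\<close> with positive exponent is non-zero.\<close>
  have "z \<noteq> \<zero>"
    using zw w_nonzero[of "E * q ^ t"] q_pos by (auto simp: nat_pow_zero)
  then have z: "z \<in> carrier (Multiplicative_Group.mult_of L)" using z_cl by simp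
  have "G.ord z > 0"
    using G.ord_ge_1[OF _ z] finite_L by simp
  then have "G.ord (w (E * q ^ t)) \<le> G.ord z"
    using G.ord_pow_gen[OF z, of "q ^ t"] zw by (simp add: Multiplicative_Group.nat_pow_mult_of)
  then show "U_part (r - 2) (p - 1) \<le> G.ord z"
    and "a \<noteq> \<one>\<^bsub>K\<^esub> \<Longrightarrow> a \<noteq> \<ominus>\<^bsub>K\<^esub> \<one>\<^bsub>K\<^esub> \<Longrightarrow> (U_part ((r - 3) div 2) (p - 1))\<^sup>2 \<le> G.ord z"
    using U_part_le_ord_w[of "E * q ^ t"] w_order[of "E * q ^ t"] by linarith+
qed

end

text \<open>Stated for monoids so that it applies to the multiplicative monoid of the quotient
  field, zero included. For negative \<open>e\<close>, the power
  \<open>x [^] nat (e mod int r)\<close> is the inverse of \<open>x [^] nat (- e)\<close>, as the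
  two exponents add up to a multiple of \<open>r\<close>.\<close>

lemma (in monoid) int_pow_mod:
  fixes e :: int and r :: nat
  assumes x: "x \<in> carrier G" "x [^] r = \<one>" and r: "r > 0"
  shows "x [^] e = x [^] nat (e mod int r)"
proof -
  have mult: "x [^] n = \<one>" if "r dvd n" for n
    using that x by (auto simp: nat_pow_pow[symmetric] elim!: dvdE)
  show ?thesis
  proof (cases "e \<ge> 0")
    case True
    have "x [^] (r * (nat e div r) + nat e mod r) = x [^] (r * (nat e div r)) \<otimes> x [^] (nat e mod r)"
      using x by (simp only: nat_pow_mult)
    also have "x [^] (r * (nat e div r)) = \<one>" by (rule mult) simp
    finally have "x [^] nat e = x [^] (nat e mod r)"
      using x(1) by (simp only: mult_div_mod_eq l_one nat_pow_closed)
    moreover have "nat (e mod int r) = nat e mod r"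
      using True by (simp add: nat_mod_distrib)
    moreover have "x [^] e = x [^] nat e"
      using True int_pow_def2[of G x e] by simp
    ultimately show ?thesis by (simp only:)
  next
    case False
    define m n where "m = nat (- e)" and "n = nat (e mod int r)"
    have "int (m + n) = int r * (- (e div int r))"
    proof -
      have "int m = - e" using False by (simp add: m_def)
      moreover have "int n = e mod int r" using r by (simp add: n_def)
      moreover have "e mod int r = e - int r * (e div int r)" by (rule minus_mult_div_eq_mod[symmetric])
      ultimately show ?thesis by simp
    qed
    then have "r dvd m + n"
      by (metis dvd_triv_left int_dvd_int_iff)
    then have "x [^] m \<otimes> x [^] n = \<one>" "x [^] n \<otimes> x [^] m = \<one>"
      using mult x by (simp_all add: nat_pow_mult add.commute)
    then have "inv (x [^] m) = x [^] n"
      using x by (intro inv_unique'[symmetric]) auto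
    moreover have "x [^] e = inv (x [^] m)"
      using False int_pow_def2[of G x e] by (simp add: m_def)
    ultimately show ?thesis by (simp only: n_def)
  qed
qed

theorem theorem1:
  fixes K :: "('a, 'b) ring_scheme"
    and p q k r :: nat
    and e f :: int
    and a :: 'a
  assumes "Factorial_Ring.prime p" and "k \<ge> 1" and "q = p ^ k"
    and "Factorial_Ring.prime r" and "odd r" and "coprime r q" and "ord r q = r - 1"
    and "field K" and "finite (carrier K)" and "card (carrier K) = q"
    and "coprime f (int r)"
    and "a \<in> carrier K" and "a \<noteq> \<zero>\<^bsub>K\<^esub>"
  shows "group.ord (Multiplicative_Group.mult_of (cyclo_ext K r)) (cyclo_elem K r e f a) \<ge> U_part (r - 2) (p - 1)
       \<and> (a \<noteq> \<one>\<^bsub>K\<^esub> \<and> a \<noteq> \<ominus>\<^bsub>K\<^esub> \<one>\<^bsub>K\<^esub> \<longrightarrow>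
          real (group.ord (Multiplicative_Group.mult_of (cyclo_ext K r)) (cyclo_elem K r e f a))
            \<ge> 1 / 2 * (real (U_part ((r - 3) div 2) (p - 1)))\<^sup>2)"
proof -
  interpret K: field K by fact
  let ?L = "cyclo_ext K r" and ?h = "cyclo_class K r"
  note closed = K.cyclo_poly_closed[of r]
  have r2: "r \<ge> 2" using assms(4) by (rule prime_ge_2_nat)
  have deg: "degree (cyclo_poly K r) = r - 1" "cyclo_poly K r \<noteq> []"
    using r2 by (auto simp: cyclo_poly_def)
  have h_eq: "?h = K.rupture_surj (carrier K) (cyclo_poly K r)"
    by (rule ext) (simp add: cyclo_class_def)
  have "pirreducible\<^bsub>K\<^esub> (carrier K) (cyclo_poly K r)"
    using assms by (intro K.cyclo_poly_irreducible[of p k]) auto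
  then have L: "field ?L"
    using K.rupture_is_field_iff_pirreducible[OF K.carrier_is_subfield closed] by (simp add: cyclo_ext_def)
  interpret L: field ?L by (rule L)
  have hom: "?h \<in> ring_hom (poly_ring K) ?L"
    using K.rupture_surj_hom(1)[OF K.carrier_is_subring closed] by (simp add: h_eq cyclo_ext_def)
  have "card (carrier ?L) = q ^ (r - 1)"
    using K.card_rupture[OF assms(9) closed deg(2)] deg(1) assms(10) by (simp add: cyclo_ext_def)
  then have fin: "finite (carrier ?L)"
    using prime_gt_0_nat[OF assms(1)] assms(3) by (intro card_ge_0_finite) simp
  interpret poly: ring "poly_ring K"
    by (rule K.univ_poly_is_ring[OF K.carrier_is_subring])
  have "?h (cyclo_poly K r) = \<zero>\<^bsub>?L\<^esub>"
    using K.rupture_surj_eq_zero_iff[OF closed closed] closed by (simp add: h_eq cyclo_ext_def)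
  then have theta: "?h X\<^bsub>K\<^esub> [^]\<^bsub>?L\<^esub> r = \<one>\<^bsub>?L\<^esub>"
    by (rule K.hom_var_pow_eq_one[OF L.domain_axioms hom])
  interpret C: cyclotomic_extension K ?L ?h p r q k a
  \<comment> \<open>Evaluation is the quotient map, which separates polynomials of degree below
    \<open>r - 1\<close>.\<close>
  proof unfold_locales
    fix x y assume "x \<in> carrier (poly_ring K)" "y \<in> carrier (poly_ring K)"
      "degree x < r - 1" "degree y < r - 1" "?h x = ?h y"
    then show "x = y"
      using K.rupture_surj_eq_imp_eq[OF closed, of x y] by (simp only: deg h_eq)
  next
    show "a [^]\<^bsub>K\<^esub> q = a"
      using K.finite_field_pow_card[OF assms(9,12)] assms(10) by simp
  qed (use assms fin hom theta K.finite_field_char in auto)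
  have theta_eq: "cyclo_theta K r = C.\<theta>" and c_eq: "cyclo_const K r a = C.c"
    by (simp_all add: cyclo_theta_def C.\<theta>_def cyclo_const_def C.c_def C.C_def)
  \<comment> \<open>Integer exponents, negative ones included, are reduced to natural residues
    modulo \<open>r\<close>.\<close>
  have pow: "C.\<theta> [^]\<^bsub>?L\<^esub> i = C.\<theta> [^]\<^bsub>?L\<^esub> nat (i mod int r)" for i :: int
    using theta r2 by (intro L.int_pow_mod) (auto simp: C.\<theta>_def)
  have elem: "cyclo_elem K r e f a = C.\<theta> [^]\<^bsub>?L\<^esub> nat (e mod int r) \<otimes>\<^bsub>?L\<^esub>
      (C.\<theta> [^]\<^bsub>?L\<^esub> nat (f mod int r) \<oplus>\<^bsub>?L\<^esub> C.c)"
    unfolding cyclo_elem_def theta_eq c_eq by (simp only: pow[of e] pow[of f])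
  have "coprime (int (nat (f mod int r))) (int r)"
    using assms(11) r2 by simp
  then have cop: "coprime (nat (f mod int r)) r" by (simp only: coprime_int_iff)
  have sq: "(real (U_part ((r - 3) div 2) (p - 1)))\<^sup>2 \<le> real (C.G.ord (cyclo_elem K r e f a))"
    if "a \<noteq> \<one>\<^bsub>K\<^esub>" "a \<noteq> \<ominus>\<^bsub>K\<^esub> \<one>\<^bsub>K\<^esub>"
    using C.ord_bounds(2)[OF cop that, of "nat (e mod int r)"] unfolding elem
    by (metis of_nat_le_iff of_nat_power)
  \<comment> \<open>The bound \<open>sq\<close> is stronger; the factor one half only weakens
    it.\<close>
  have "1 / 2 * (real (U_part ((r - 3) div 2) (p - 1)))\<^sup>2 \<le> real (C.G.ord (cyclo_elem K r e f a))"
    if "a \<noteq> \<one>\<^bsub>K\<^esub>" "a \<noteq> \<ominus>\<^bsub>K\<^esub> \<one>\<^bsub>K\<^esub>"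
  proof -
    have half: "1 / 2 * x \<le> y" if "x \<le> y" "0 \<le> x" for x y :: real
      using that by linarith
    show ?thesis by (rule half[OF sq[OF that] zero_le_power2])
  qed
  then show ?thesis
    using C.ord_bounds(1)[OF cop, of "nat (e mod int r)"] unfolding elem by blast
qed

end
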